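(* Let $d\in\{2,3\}$, $D=\mathbb{R}^d\times(0,+\infty)$ and let $N\subset D$ be a manifold. Let $\overline A=(A_1\ A_2)$, $\overline A(f,h)=A_1f+A_2h$, be the (generalized) solution operator of the Cauchy problem $x_{tt}-\Delta x=f$ in $D$, $x(u,0)=0$, $x_t(u,0)=h(u)$, $u\in\mathbb{R}^d$, given for $(u,t)\in N$ by the Poisson formula when $d=2$: $$(A_1f)(u,t)=\frac1{2\pi}\int_0^t\!\int_{B_s(u)}\frac{f(v,t-s)}{\sqrt{s^2-|u-v|^2}}\,d\mu(v)\,d\mu(s),\qquad(A_2h)(u,t)=\frac1{2\pi}\int_{B_t(u)}\frac{h(v)\,d\mu(v)}{\sqrt{t^2-|u-v|^2}},$$ and by the Kirchhoff formula when $d=3$: $$(A_1f)(u,t)=\frac1{4\pi}\int_{B_t(u)}\frac{f(v,t-|u-v|)}{|u-v|}\,d\mu(v),\qquad(A_2h)(u,t)=\frac1{4\pi t}\int_{S_t(u)}h(v)\,d\sigma(v).$$ Let $M_1\subset D$ and $M_2\subset\mathbb{R}^d$ be compact sets and, for $i=1,2$, let $\omega_i$ be a modulus of continuity, $W_i=H^{\omega_i}_\mu(M_i)$, $Q_i$ a set of $n_i\in\mathbb{N}$ points of $M_i$, $e_i\in\mathbb{R}^{n_i}_+$, $I_i=I_{Q_i}$, $U_i=U_{e_i}$, $L_i=L_{\omega_i,Q_i,e_i}$, $\tau_i=\tau_{\omega_i,Q_i,e_i}$; put $\overline W=W_1\times W_2$, $\overline I=\mathrm{diag}(I_1,I_2)$,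 $\overline U=U_1\times U_2$. Let $Y\subset\mathfrak{M}(N,\mu)$ be a normed lattice containing the $\mu$-essentially bounded and integrable functions on $N$, and such that $A_i(B_\mu(M_i))\subset Y$, $i=1,2$. Then $\Phi=\overline A\,\overline L$, $\overline L=\mathrm{diag}(L_1,L_2)$, is an optimal method of recovery of the operator $\overline A$ on the class $\overline W$ based on information $\overline I$ with $\overline U$-error, and $$\mathcal{E}(\overline A;\overline W;\overline I;\overline U)=\mathcal{E}(\overline A;\overline W;\overline I;\overline U;\Phi)=\|\overline A\,\overline\tau\|_Y,\qquad\overline\tau=\tau_1\times\tau_2,\quad\overline A\,\overline\tau=A_1\tau_1+A_2\tau_2.$$
   Context: $\mu$ denotes Lebesgue measure of the dimension of the set or manifold on which it is considered; $\Delta$ is the Laplacian in the space variables; $B_t(u)$ and $S_t(u)$ are the Euclidean ball and sphere in $\mathbb{R}^d$ centered at $u$ with radius $t>0$; $\sigma$ is the surface area measure on $S_t(u)$. $D$ and $\mathbb{R}^d$ carry the Euclidean metric. Here $B_\mu(M_i)$ is the set of bounded Borel functions on the ambient space ($D$ for $i=1$, $\mathbb{R}^d$ for $i=2$) vanishing outside $M_i$, and the operators $A_i$ act on it by the pointwise formulas above. $\mathbb{R}_+=[0,\infty)$. A modulus of continuity is a continuous non-decreasing $\omega:\mathbb{R}_+\to\mathbb{R}_+$ with $\omega(0)=0$ and $\omega(t'+t'')\le\omega(t')+\omega(t'')$. For $M=D$ or $M=\mathbb{R}^d$ with Euclidean metric $\rho$ and compact $M'\subset M$: $H^\omega_\mu(M')$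 is the set of functions $x=y\cdot\chi_{M'}$, $y:M\to\mathbb{R}$ continuous, with $|x(t')-x(t'')|\le\omega(\rho(t',t''))$ for all $t',t''\in M'$. For $Q=\{q_1,\dots,q_n\}\subset M'$ and $e=(e^1,\dots,e^n)\in\mathbb{R}^n_+$: $I_Qx=(x(q_1),\dots,x(q_n))$; $U_e=[-e^1,e^1]\times\dots\times[-e^n,e^n]$; $\tau_{\omega,Q,e}(t)=\min_{1\le j\le n}(e^j+\omega(\rho(t,q_j)))$ for $t\in M'$ and $0$ on $M\setminus M'$; $\Pi'_j=\{t\in M':\tau_{\omega,Q,e}(t)=e^j+\omega(\rho(t,q_j))\}$, $\Pi_1=\Pi'_1$, $\Pi_j=\Pi'_j\setminus\bigcup_{s<j}\Pi_s$; $L_{\omega,Q,e}z(t)=z_j$ for $t\in\Pi_j$ and $0$ on $M\setminus M'$, $z\in\mathbb{R}^n$. $\mathfrak{M}(N,\mu)$ is the space of measurable a.e. finite functions on $N$ modulo a.e. equality, ordered by $x'\prec x''$ iff $x'\le x''$ a.e. A normed lattice $Y\subset\mathfrak{M}(N,\mu)$ is a normed space which is a vector lattice for the inherited order with $|x|\prec|y|\Rightarrow\|x\|_Y\le\|y\|_Y$. $\overline I(f,h)=(I_1f,I_2h)$; $\overline A\,\overline L(z_1,z_2)=A_1L_1z_1+A_2L_2z_2$. A method of recovery is an arbitrary map $\Phi:\mathbb{R}^{n_1}\times\mathbb{R}^{n_2}\to Y$; $\mathcal{E}(\overline A;\overline W;\overline I;\overline U;\Phi)=\sup_{\overline x\in\overline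 W}\sup_{\overline z\in\overline I\,\overline x+\overline U}\|\overline A\,\overline x-\Phi\overline z\|_Y$; $\mathcal{E}(\overline A;\overline W;\overline I;\overline U)$ is its infimum over $\Phi$; a method is optimal if it attains this infimum. *)

theory Defs
  imports "HOL-Analysis.Analysis"
begin

section \<open>Lebesgue measure on submanifolds\<close>

text \<open>
  The Lebesgue (surface) measure of a \<open>k\<close>-dimensional submanifold of a Euclidean space is the
  \<open>k\<close>-dimensional Hausdorff measure, normalized by the volume of the \<open>k\<close>-dimensional unit ball.
  It is the counting measure for \<open>k = 0\<close> and Lebesgue measure if \<open>k\<close> is the dimension of the
  ambient space. The empty set is treated separately because of \<open>0 ^ 0 = 1\<close>, and the covering sets
  have to be bounded because \<open>diameter\<close> is meaningless for unbounded sets.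
\<close>

definition hausdorff_weight :: "nat \<Rightarrow> 'a::euclidean_space set \<Rightarrow> ennreal" where
  "hausdorff_weight k C =
     (if C = {} then 0 else ennreal (unit_ball_vol (real k) * (diameter C / 2) ^ k))"

definition hausdorff_content :: "nat \<Rightarrow> real \<Rightarrow> 'a::euclidean_space set \<Rightarrow> ennreal" where
  "hausdorff_content k \<delta> S =
     (INF C \<in> {C :: nat \<Rightarrow> 'a set. S \<subseteq> (\<Union>i. C i) \<and> (\<forall>i. bounded (C i) \<and> diameter (C i) \<le> \<delta>)}.
        \<Sum>i. hausdorff_weight k (C i))"

definition hausdorff_outer_measure :: "nat \<Rightarrow> 'a::euclidean_space set \<Rightarrow> ennreal" where
  "hausdorff_outer_measure k S = (SUP \<delta> \<in> {0<..}. hausdorff_content k \<delta> S)"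

definition hausdorff_measure :: "nat \<Rightarrow> 'a::euclidean_space measure" where
  "hausdorff_measure k = measure_of UNIV (sets borel) (hausdorff_outer_measure k)"

definition C1_on :: "'a::euclidean_space set \<Rightarrow> ('a \<Rightarrow> 'b::euclidean_space) \<Rightarrow> bool" where
  "C1_on V f \<longleftrightarrow> (\<exists>f' :: 'a \<Rightarrow> 'a \<Rightarrow>\<^sub>L 'b.
     (\<forall>x\<in>V. (f has_derivative blinfun_apply (f' x)) (at x)) \<and> continuous_on V f')"

text \<open>Embedded submanifolds without boundary: locally, a diffeomorphism straightens the set to a
  piece of a \<open>k\<close>-dimensional linear subspace.\<close>

definition C1_submanifold :: "nat \<Rightarrow> 'a::euclidean_space set \<Rightarrow> bool" where
  "C1_submanifold k N \<longleftrightarrow> (\<forall>p\<in>N. \<exists>V W \<phi> \<psi> (S :: 'a set).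
     open V \<and> p \<in> V \<and> open W \<and> homeomorphism V W \<phi> \<psi> \<and> C1_on V \<phi> \<and> C1_on W \<psi> \<and>
     subspace S \<and> dim S = k \<and> \<phi> ` (V \<inter> N) = W \<inter> S)"

text \<open>The completion makes the measurable functions on \<open>N\<close> those that are measurable
  in the sense of Lebesgue.\<close>

definition manifold_measure :: "nat \<Rightarrow> 'a::euclidean_space set \<Rightarrow> 'a measure" where
  "manifold_measure k N = completion (restrict_space (hausdorff_measure k) N)"


section \<open>Normed lattices of measurable functions\<close>

text \<open>
  The space of measurable, a.e. finite functions modulo a.e. equality is rendered by real-valued
  representatives: a set of classes is a set \<open>Y\<close> of measurable functions saturated under a.e.
  equality, and a function on classes is one that does not distinguish a.e. equal representatives.
\<close>

definition ae_le :: "'x measure \<Rightarrow> ('x \<Rightarrow> real) \<Rightarrow> ('x \<Rightarrow> real) \<Rightarrow> bool" where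
  "ae_le M x y \<longleftrightarrow> (AE p in M. x p \<le> y p)"

definition ae_eq :: "'x measure \<Rightarrow> ('x \<Rightarrow> real) \<Rightarrow> ('x \<Rightarrow> real) \<Rightarrow> bool" where
  "ae_eq M x y \<longleftrightarrow> (AE p in M. x p = y p)"

text \<open>The supremum is taken in the ordered space \<open>Y\<close>; it is not required to be the pointwise
  maximum.\<close>

definition is_lattice_sup ::
  "'x measure \<Rightarrow> ('x \<Rightarrow> real) set \<Rightarrow> ('x \<Rightarrow> real) \<Rightarrow> ('x \<Rightarrow> real) \<Rightarrow> ('x \<Rightarrow> real) \<Rightarrow> bool" where
  "is_lattice_sup M Y x y s \<longleftrightarrow>
     s \<in> Y \<and> ae_le M x s \<and> ae_le M y s \<and> (\<forall>z\<in>Y. ae_le M x z \<and> ae_le M y z \<longrightarrow> ae_le M s z)"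

definition is_lattice_abs ::
  "'x measure \<Rightarrow> ('x \<Rightarrow> real) set \<Rightarrow> ('x \<Rightarrow> real) \<Rightarrow> ('x \<Rightarrow> real) \<Rightarrow> bool" where
  "is_lattice_abs M Y x a \<longleftrightarrow> is_lattice_sup M Y x (\<lambda>p. - x p) a"

definition normed_space_of_functions ::
  "'x measure \<Rightarrow> ('x \<Rightarrow> real) set \<Rightarrow> (('x \<Rightarrow> real) \<Rightarrow> real) \<Rightarrow> bool" where
  "normed_space_of_functions M Y nrm \<longleftrightarrow>
     Y \<subseteq> borel_measurable M \<and>
     (\<forall>x\<in>Y. \<forall>y\<in>borel_measurable M. ae_eq M x y \<longrightarrow> y \<in> Y \<and> nrm y = nrm x) \<and>
     (\<lambda>p. 0) \<in> Y \<and>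
     (\<forall>x\<in>Y. \<forall>y\<in>Y. (\<lambda>p. x p + y p) \<in> Y) \<and>
     (\<forall>c. \<forall>x\<in>Y. (\<lambda>p. c * x p) \<in> Y) \<and>
     (\<forall>x\<in>Y. 0 \<le> nrm x) \<and>
     (\<forall>x\<in>Y. nrm x = 0 \<longleftrightarrow> ae_eq M x (\<lambda>p. 0)) \<and>
     (\<forall>x\<in>Y. \<forall>y\<in>Y. nrm (\<lambda>p. x p + y p) \<le> nrm x + nrm y) \<and>
     (\<forall>c. \<forall>x\<in>Y. nrm (\<lambda>p. c * x p) = \<bar>c\<bar> * nrm x)"

text \<open>Infima exist along with suprema, since negation reverses the order.\<close>

definition normed_lattice ::
  "'x measure \<Rightarrow> ('x \<Rightarrow> real) set \<Rightarrow> (('x \<Rightarrow> real) \<Rightarrow> real) \<Rightarrow> bool" where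
  "normed_lattice M Y nrm \<longleftrightarrow>
     normed_space_of_functions M Y nrm \<and>
     (\<forall>x\<in>Y. \<forall>y\<in>Y. \<exists>s. is_lattice_sup M Y x y s) \<and>
     (\<forall>x\<in>Y. \<forall>y\<in>Y. \<forall>a b.
        is_lattice_abs M Y x a \<longrightarrow> is_lattice_abs M Y y b \<longrightarrow> ae_le M a b \<longrightarrow> nrm x \<le> nrm y)"


section \<open>Classes of functions and information\<close>

definition modulus_of_continuity :: "(real \<Rightarrow> real) \<Rightarrow> bool" where
  "modulus_of_continuity \<omega> \<longleftrightarrow>
     continuous_on {0..} \<omega> \<and> mono_on {0..} \<omega> \<and> \<omega> 0 = 0 \<and> (\<forall>t\<ge>0. 0 \<le> \<omega> t) \<and>
     (\<forall>t\<ge>0. \<forall>t'\<ge>0. \<omega> (t + t') \<le> \<omega> t + \<omega> t')"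

text \<open>Below, \<open>M\<close> is the ambient set, a subset of the type \<open>'a\<close>, and \<open>K\<close> is its compact subset.
  All functions considered vanish outside \<open>K\<close>, so that there is no need to restrict them
  to \<open>M\<close>.\<close>

definition bounded_borel :: "'a::euclidean_space set \<Rightarrow> ('a \<Rightarrow> real) set" where
  "bounded_borel K = {f \<in> borel_measurable borel. bounded (range f) \<and> (\<forall>p. p \<notin> K \<longrightarrow> f p = 0)}"

definition H_class ::
  "'a::euclidean_space set \<Rightarrow> (real \<Rightarrow> real) \<Rightarrow> 'a set \<Rightarrow> ('a \<Rightarrow> real) set" where
  "H_class M \<omega> K = {x. (\<exists>y. continuous_on M y \<and> x = (\<lambda>p. y p * indicator K p)) \<and>
     (\<forall>p\<in>K. \<forall>p'\<in>K. \<bar>x p - x p'\<bar> \<le> \<omega> (dist p p'))}"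

text \<open>A set of \<open>n\<close> points is enumerated by a finite linearly ordered index type with \<open>n\<close>
  elements; the order is used in the definition of the cells.\<close>

definition info :: "('n::finite \<Rightarrow> 'a) \<Rightarrow> ('a \<Rightarrow> real) \<Rightarrow> real ^ 'n" where
  "info q x = (\<chi> j. x (q j))"

definition error_box :: "real ^ ('n::finite) \<Rightarrow> (real ^ 'n) set" where
  "error_box e = {z. \<forall>j. - e $ j \<le> z $ j \<and> z $ j \<le> e $ j}"

definition tau ::
  "'a::euclidean_space set \<Rightarrow> (real \<Rightarrow> real) \<Rightarrow> ('n::finite \<Rightarrow> 'a) \<Rightarrow> real ^ 'n \<Rightarrow> 'a \<Rightarrow> real" where
  "tau K \<omega> q e p = (if p \<in> K then (MIN j. e $ j + \<omega> (dist p (q j))) else 0)"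

definition pre_cell ::
  "'a::euclidean_space set \<Rightarrow> (real \<Rightarrow> real) \<Rightarrow> ('n::finite \<Rightarrow> 'a) \<Rightarrow> real ^ 'n \<Rightarrow> 'n \<Rightarrow> 'a set" where
  "pre_cell K \<omega> q e j = {p \<in> K. tau K \<omega> q e p = e $ j + \<omega> (dist p (q j))}"

function cell ::
  "'a::euclidean_space set \<Rightarrow> (real \<Rightarrow> real) \<Rightarrow> ('n::{finite,linorder} \<Rightarrow> 'a) \<Rightarrow>
   real ^ ('n::{finite,linorder}) \<Rightarrow> 'n \<Rightarrow> 'a set"
where
  "cell K \<omega> q e j = pre_cell K \<omega> q e j - (\<Union>s\<in>{..<j}. cell K \<omega> q e s)"
  by pat_completeness auto
termination
  by (relation "Wellfounded.measure (\<lambda>(K, \<omega>, q, e, j). card {..<j})") (auto intro!: psubset_card_mono)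

declare cell.simps [simp del]

text \<open>The cells form a partition of \<open>K\<close>, so the index below is unique.\<close>

definition interpolant ::
  "'a::euclidean_space set \<Rightarrow> (real \<Rightarrow> real) \<Rightarrow> ('n::{finite,linorder} \<Rightarrow> 'a) \<Rightarrow>
   real ^ ('n::{finite,linorder}) \<Rightarrow> real ^ ('n::{finite,linorder}) \<Rightarrow> 'a \<Rightarrow> real" where
  "interpolant K \<omega> q e z p = (if p \<in> K then z $ (THE j. p \<in> cell K \<omega> q e j) else 0)"


section \<open>The solution operator of the wave equation\<close>

definition half_space :: "('a::euclidean_space \<times> real) set" where
  "half_space = UNIV \<times> {0<..}"

text \<open>With open balls and open time intervals the source term is evaluated in the half space
  only; the boundaries have measure zero.\<close>

definition poisson_source ::
  "('a::euclidean_space \<times> real \<Rightarrow> real) \<Rightarrow> 'a \<times> real \<Rightarrow> real" where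
  "poisson_source f = (\<lambda>(u, t). 1 / (2 * pi) *
     (LINT s:{0<..<t}|lborel. LINT v:ball u s|lborel. f (v, t - s) / sqrt (s\<^sup>2 - (norm (u - v))\<^sup>2)))"

definition poisson_velocity :: "('a::euclidean_space \<Rightarrow> real) \<Rightarrow> 'a \<times> real \<Rightarrow> real" where
  "poisson_velocity h = (\<lambda>(u, t). 1 / (2 * pi) *
     (LINT v:ball u t|lborel. h v / sqrt (t\<^sup>2 - (norm (u - v))\<^sup>2)))"

definition kirchhoff_source ::
  "('a::euclidean_space \<times> real \<Rightarrow> real) \<Rightarrow> 'a \<times> real \<Rightarrow> real" where
  "kirchhoff_source f = (\<lambda>(u, t). 1 / (4 * pi) *
     (LINT v:ball u t|lborel. f (v, t - norm (u - v)) / norm (u - v)))"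

definition kirchhoff_velocity :: "('a::euclidean_space \<Rightarrow> real) \<Rightarrow> 'a \<times> real \<Rightarrow> real" where
  "kirchhoff_velocity h = (\<lambda>(u, t). 1 / (4 * pi * t) *
     (LINT v:sphere u t|hausdorff_measure 2. h v))"

text \<open>These are used in dimensions two and three only.\<close>

definition wave_source ::
  "('a::euclidean_space \<times> real \<Rightarrow> real) \<Rightarrow> 'a \<times> real \<Rightarrow> real" where
  "wave_source = (if DIM('a) = 2 then poisson_source else kirchhoff_source)"

definition wave_velocity :: "('a::euclidean_space \<Rightarrow> real) \<Rightarrow> 'a \<times> real \<Rightarrow> real" where
  "wave_velocity = (if DIM('a) = 2 then poisson_velocity else kirchhoff_velocity)"

definition wave_operator ::
  "('a::euclidean_space \<times> real \<Rightarrow> real) \<times> ('a \<Rightarrow> real) \<Rightarrow> 'a \<times> real \<Rightarrow> real" where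
  "wave_operator = (\<lambda>(f, h) p. wave_source f p + wave_velocity h p)"


section \<open>Optimal recovery\<close>

text \<open>Errors take values in the extended reals, since the error of an arbitrary recovery map may be
  infinite. Recovery maps take values in \<open>Y\<close>.\<close>

definition recovery_error ::
  "(('x \<Rightarrow> real) \<Rightarrow> real) \<Rightarrow> ('w \<Rightarrow> 'x \<Rightarrow> real) \<Rightarrow> 'w set \<Rightarrow> ('w \<Rightarrow> 'z::plus) \<Rightarrow> 'z set \<Rightarrow>
   ('z \<Rightarrow> 'x \<Rightarrow> real) \<Rightarrow> ereal" where
  "recovery_error nrm A W I U \<Phi> =
     (SUP x\<in>W. SUP z\<in>{I x + u | u. u \<in> U}. ereal (nrm (\<lambda>p. A x p - \<Phi> z p)))"

definition optimal_error ::
  "('x \<Rightarrow> real) set \<Rightarrow> (('x \<Rightarrow> real) \<Rightarrow> real) \<Rightarrow> ('w \<Rightarrow> 'x \<Rightarrow> real) \<Rightarrow> 'w set \<Rightarrow> ('w \<Rightarrow> 'z::plus) \<Rightarrow>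
   'z set \<Rightarrow> ereal" where
  "optimal_error Y nrm A W I U = (INF \<Phi>\<in>{\<Phi>. range \<Phi> \<subseteq> Y}. recovery_error nrm A W I U \<Phi>)"

definition optimal_recovery ::
  "('x \<Rightarrow> real) set \<Rightarrow> (('x \<Rightarrow> real) \<Rightarrow> real) \<Rightarrow> ('w \<Rightarrow> 'x \<Rightarrow> real) \<Rightarrow> 'w set \<Rightarrow> ('w \<Rightarrow> 'z::plus) \<Rightarrow>
   'z set \<Rightarrow> ('z \<Rightarrow> 'x \<Rightarrow> real) \<Rightarrow> bool" where
  "optimal_recovery Y nrm A W I U \<Phi> \<longleftrightarrow>
     range \<Phi> \<subseteq> Y \<and> recovery_error nrm A W I U \<Phi> = optimal_error Y nrm A W I U"

end

theory Submission
  imports Defs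
begin

text \<open>
  The solution operators are positive and linear on bounded Borel functions, because the kernels
  are nonnegative and integrable. An element \<open>x\<close> of the class with information \<open>z\<close>
  satisfies \<open>\<bar>x - L z\<bar> \<le> \<tau>\<close> pointwise, so positivity bounds the error of \<open>A L\<close> by the norm
  of \<open>A \<tau>\<close>. Conversely, \<open>\<tau>\<close> and \<open>- \<tau>\<close> belong to the class and are both compatible with the
  information \<open>0\<close>, so no method can do better.
\<close>

section \<open>Optimal recovery with positive linear operators\<close>

text \<open>The interpolant \<open>L z\<close> jumps across cell boundaries, so the operators must
  be positive and linear on all bounded Borel functions that vanish outside the compact set, not
  only on continuous ones. Linearity is not automatic there: the integral of a non-integrable
  function is 0 by convention, and additivity can then fail. The analytic work is therefore the
  integrability of the kernels. The Poisson kernel is singular at the rim of the ball, the Kirchhoff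
  source kernel at its centre, and the mean over a sphere requires finite surface measure. Since
  that measure is a Hausdorff measure, its finiteness comes from a packing argument rather than from
  a parametrization.\<close>

lemma continuous_on_Min_image:
  fixes f :: "'i \<Rightarrow> 'a::topological_space \<Rightarrow> real"
  assumes "finite A" "A \<noteq> {}" and "\<And>j. j \<in> A \<Longrightarrow> continuous_on S (f j)"
  shows "continuous_on S (\<lambda>p. MIN j\<in>A. f j p)"
  using assms
proof (induction A rule: finite_ne_induct)
  case (insert i A)
  then have "(\<lambda>p. MIN j\<in>insert i A. f j p) = (\<lambda>p. min (f i p) (MIN j\<in>A. f j p))"
    by (simp add: Min_insert)
  with insert show ?case
    by (auto intro!: continuous_on_min)
qed auto

section \<open>Moduli of continuity and the extremal function \<open>tau\<close>\<close>

lemma modulus_comp_dist_continuous: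
  assumes "modulus_of_continuity \<omega>"
  shows "continuous_on S (\<lambda>p. a + \<omega> (dist p c))"
proof -
  have "continuous_on {0..} \<omega>" using assms by (simp add: modulus_of_continuity_def)
  then have "continuous_on S (\<lambda>p. \<omega> (dist p c))"
    by (rule continuous_on_compose2) (auto intro: continuous_on_dist)
  then show ?thesis by (rule continuous_on_add[OF continuous_on_const])
qed

text \<open>Monotonicity and subadditivity together let \<open>\<omega>\<close> inherit the triangle
  inequality of the metric.\<close>

lemma modulus_dist_triangle:
  assumes "modulus_of_continuity \<omega>"
  shows "\<omega> (dist p c) \<le> \<omega> (dist p p') + \<omega> (dist p' c)"
proof -
  have "\<omega> (dist p c) \<le> \<omega> (dist p p' + dist p' c)"
    using assms unfolding modulus_of_continuity_def
    by (auto intro!: mono_onD[of "{0..}" \<omega>] dist_triangle)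
  also have "\<dots> \<le> \<omega> (dist p p') + \<omega> (dist p' c)"
    using assms unfolding modulus_of_continuity_def by simp
  finally show ?thesis .
qed

lemma tau_le: "tau K \<omega> q e p \<le> e $ j + \<omega> (dist p (q j))" if "p \<in> K"
  using that by (auto simp: tau_def)

lemma tau_attained:
  assumes "p \<in> K"
  obtains j where "tau K \<omega> q e p = e $ j + \<omega> (dist p (q j))"
proof -
  have "(MIN j. e $ j + \<omega> (dist p (q j))) \<in> range (\<lambda>j. e $ j + \<omega> (dist p (q j)))"
    by (rule Min_in) auto
  then obtain j where "(MIN j. e $ j + \<omega> (dist p (q j))) = e $ j + \<omega> (dist p (q j))"
    by (elim imageE)
  with assms show ?thesis by (intro that[of j]) (simp add: tau_def)
qed

lemma tau_nonneg:
  assumes "modulus_of_continuity \<omega>" and "\<And>j. 0 \<le> e $ j"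
  shows "0 \<le> tau K \<omega> q e p"
proof (cases "p \<in> K")
  case True
  then obtain j where "tau K \<omega> q e p = e $ j + \<omega> (dist p (q j))" by (rule tau_attained)
  with assms show ?thesis by (simp add: modulus_of_continuity_def)
qed (simp add: tau_def)

text \<open>Because \<open>\<omega> 0 = 0\<close>, the term of index \<open>j\<close> in the minimum
  reduces to \<open>e $ j\<close> at its own node. This is what makes the information 0 admissible
  for \<open>tau\<close> and its negative.\<close>

lemma tau_node:
  assumes "modulus_of_continuity \<omega>" and "q j \<in> K"
  shows "tau K \<omega> q e (q j) \<le> e $ j"
  using tau_le[OF assms(2), where j = j and \<omega> = \<omega> and q = q and e = e] assms(1)
  by (simp add: modulus_of_continuity_def)

text \<open>Each function under the minimum varies by at most \<open>\<omega>\<close> of the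
  distance, and a finite minimum keeps that bound: an index attaining the minimum at
  \<open>p'\<close> still gives an upper bound at \<open>p\<close>.\<close>

lemma tau_in_H_class:
  assumes "modulus_of_continuity \<omega>"
  shows "tau K \<omega> q e \<in> H_class S \<omega> K"
proof -
  have le: "tau K \<omega> q e p \<le> tau K \<omega> q e p' + \<omega> (dist p p')" if "p \<in> K" "p' \<in> K" for p p'
  proof -
    obtain j where "tau K \<omega> q e p' = e $ j + \<omega> (dist p' (q j))"
      using \<open>p' \<in> K\<close> by (rule tau_attained)
    with tau_le[OF \<open>p \<in> K\<close>, where j = j and \<omega> = \<omega> and q = q and e = e]
      modulus_dist_triangle[OF assms, of p "q j" p']
    show ?thesis by simp
  qed
  \<comment> \<open>The minimum without the cut-off to \<open>K\<close> is continuous everywhere and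
    serves as the required extension.\<close>
  let ?y = "\<lambda>p. MIN j. e $ j + \<omega> (dist p (q j))"
  have "continuous_on S ?y"
    by (intro continuous_on_Min_image modulus_comp_dist_continuous assms(1)) auto
  moreover have "tau K \<omega> q e = (\<lambda>p. ?y p * indicator K p)"
    by (auto simp: tau_def fun_eq_iff)
  moreover have "\<bar>tau K \<omega> q e p - tau K \<omega> q e p'\<bar> \<le> \<omega> (dist p p')" if "p \<in> K" "p' \<in> K" for p p'
    using le[OF that] le[OF that(2,1)] by (simp add: dist_commute abs_le_iff)
  ultimately show ?thesis
    unfolding H_class_def by blast
qed

section \<open>The class of functions as a symmetric set of bounded Borel functions\<close>

lemma H_class_uminus:
  assumes "x \<in> H_class S \<omega> K"
  shows "(\<lambda>p. - x p) \<in> H_class S \<omega> K"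
proof -
  obtain y where y: "continuous_on S y" "x = (\<lambda>p. y p * indicator K p)"
    using assms by (auto simp: H_class_def)
  have "continuous_on S (\<lambda>p. - y p)" "(\<lambda>p. - x p) = (\<lambda>p. - y p * indicator K p)"
    using y by (auto intro: continuous_on_minus)
  moreover have "\<bar>- x p - - x p'\<bar> \<le> \<omega> (dist p p')" if "p \<in> K" "p' \<in> K" for p p'
  proof -
    have "\<bar>x p - x p'\<bar> \<le> \<omega> (dist p p')" using assms that by (auto simp: H_class_def)
    then show ?thesis by linarith
  qed
  ultimately show ?thesis unfolding H_class_def by blast
qed

lemma H_class_bounded_borel:
  assumes "x \<in> H_class S \<omega> K" and "compact K" and "K \<subseteq> S"
  shows "x \<in> bounded_borel K"
proof -
  obtain y where y: "continuous_on S y" "x = (\<lambda>p. y p * indicator K p)"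
    using assms(1) by (auto simp: H_class_def)
  have cont: "continuous_on K y" using y(1) assms(3) by (rule continuous_on_subset)
  have K: "K \<in> sets borel" using assms(2) by (simp add: borel_compact)
  have "(\<lambda>p. indicator K p *\<^sub>R y p) \<in> borel_measurable borel"
    by (rule borel_measurable_continuous_on_indicator[OF K cont])
  then have "x \<in> borel_measurable borel"
    by (simp add: y(2) mult.commute)
  moreover have "bounded (range x)"
  proof -
    have "bounded (y ` K)"
      using compact_continuous_image[OF cont assms(2)] by (rule compact_imp_bounded)
    then have "bounded (insert 0 (y ` K))" by simp
    then show ?thesis
      by (rule bounded_subset) (auto simp: y(2) indicator_def)
  qed
  ultimately show ?thesis by (auto simp: bounded_borel_def y(2))
qed

section \<open>Cells and the piecewise constant interpolant\<close>

lemma cell_subset_pre_cell: "cell K \<omega> q e j \<subseteq> pre_cell K \<omega> q e j"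
  by (subst cell.simps) auto

text \<open>Removing earlier cells amounts to removing earlier pre-cells, because the first pre-cell
  containing a point keeps it. The recursion is thereby replaced by a least-index condition.\<close>

lemma mem_cell_iff:
  "p \<in> cell K \<omega> q e j \<longleftrightarrow> p \<in> pre_cell K \<omega> q e j \<and> (\<forall>s<j. p \<notin> pre_cell K \<omega> q e s)"
proof
  assume p: "p \<in> cell K \<omega> q e j"
  have "p \<notin> pre_cell K \<omega> q e s" if "s < j" for s
  proof
    assume s: "p \<in> pre_cell K \<omega> q e s"
    \<comment> \<open>The least index whose pre-cell contains \<open>p\<close>; nothing earlier can
      take \<open>p\<close> away from cell \<open>m\<close>, and \<open>m < j\<close> contradicts
      \<open>p\<close> being left for cell \<open>j\<close>.\<close>
    define m where "m = Min {s. p \<in> pre_cell K \<omega> q e s}"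
    have m: "p \<in> pre_cell K \<omega> q e m"
      using Min_in[of "{s. p \<in> pre_cell K \<omega> q e s}"] s by (auto simp: m_def)
    have least: "m \<le> i" if "p \<in> pre_cell K \<omega> q e i" for i
      using that by (simp add: m_def)
    have "p \<in> cell K \<omega> q e m"
      using m least cell_subset_pre_cell by (subst cell.simps) fastforce
    moreover have "m < j" using least[OF s] that by simp
    ultimately show False using p by (subst (asm) (2) cell.simps) auto
  qed
  then show "p \<in> pre_cell K \<omega> q e j \<and> (\<forall>s<j. p \<notin> pre_cell K \<omega> q e s)"
    using p cell_subset_pre_cell by blast
next
  assume "p \<in> pre_cell K \<omega> q e j \<and> (\<forall>s<j. p \<notin> pre_cell K \<omega> q e s)"
  then show "p \<in> cell K \<omega> q e j"
    using cell_subset_pre_cell by (subst cell.simps) blast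
qed

lemma cell_unique: "p \<in> cell K \<omega> q e i \<Longrightarrow> p \<in> cell K \<omega> q e j \<Longrightarrow> i = j"
  by (cases i j rule: linorder_cases) (auto simp: mem_cell_iff)

lemma interpolant_cell:
  assumes "p \<in> cell K \<omega> q e j"
  shows "interpolant K \<omega> q e z p = z $ j"
proof -
  have "(THE i. p \<in> cell K \<omega> q e i) = j"
    using assms cell_unique[OF _ assms] by (rule the_equality)
  moreover have "p \<in> K" using assms by (simp add: mem_cell_iff pre_cell_def)
  ultimately show ?thesis by (simp add: interpolant_def)
qed

lemma cell_exists:
  assumes "p \<in> K"
  obtains j where "p \<in> cell K \<omega> q e j"
proof -
  let ?J = "{j. p \<in> pre_cell K \<omega> q e j}"
  obtain i where "i \<in> ?J"
    using assms by (auto simp: pre_cell_def elim: tau_attained)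
  then have "Min ?J \<in> ?J" by (intro Min_in) auto
  moreover have "s \<notin> ?J" if "s < Min ?J" for s
  proof
    assume "s \<in> ?J"
    then have "Min ?J \<le> s" by (intro Min_le) auto
    with that show False by (meson leD)
  qed
  ultimately have "p \<in> cell K \<omega> q e (Min ?J)" unfolding mem_cell_iff by blast
  then show ?thesis by (rule that)
qed

text \<open>On cell \<open>j\<close> the minimum defining \<open>tau\<close> is attained at
  \<open>j\<close>. The variation of \<open>x\<close> from the node and the information error
  therefore add up to exactly \<open>tau\<close>, with no loss from the choice of the node.\<close>

lemma interpolant_error:
  assumes "x \<in> H_class S \<omega> K" and "u \<in> error_box e" and "range q \<subseteq> K"
  shows "\<bar>x p - interpolant K \<omega> q e (info q x + u) p\<bar> \<le> tau K \<omega> q e p"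
proof (cases "p \<in> K")
  case True
  then obtain j where j: "p \<in> cell K \<omega> q e j" by (rule cell_exists)
  then have "tau K \<omega> q e p = e $ j + \<omega> (dist p (q j))"
    by (simp add: mem_cell_iff pre_cell_def)
  moreover have "interpolant K \<omega> q e (info q x + u) p = x (q j) + u $ j"
    by (simp add: interpolant_cell[OF j] info_def)
  moreover have "\<bar>x p - x (q j)\<bar> \<le> \<omega> (dist p (q j))"
    using assms(1,3) True by (auto simp: H_class_def)
  moreover have "- e $ j \<le> u $ j" "u $ j \<le> e $ j"
    using assms(2) by (auto simp: error_box_def)
  ultimately show ?thesis by (simp add: abs_le_iff)
next
  case False
  with assms(1) show ?thesis by (auto simp: H_class_def interpolant_def tau_def)
qed

lemma pre_cell_closed:
  assumes "modulus_of_continuity \<omega>" and "closed K"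
  shows "closed (pre_cell K \<omega> q e j)"
proof -
  have "continuous_on UNIV (\<lambda>p. MIN j. e $ j + \<omega> (dist p (q j)))"
    by (intro continuous_on_Min_image modulus_comp_dist_continuous assms(1)) auto
  moreover have "continuous_on UNIV (\<lambda>p. e $ j + \<omega> (dist p (q j)))"
    by (rule modulus_comp_dist_continuous[OF assms(1)])
  ultimately have "closed {p. (MIN j. e $ j + \<omega> (dist p (q j))) = e $ j + \<omega> (dist p (q j))}"
    by (rule closed_Collect_eq)
  then have "closed (K \<inter> {p. (MIN j. e $ j + \<omega> (dist p (q j))) = e $ j + \<omega> (dist p (q j))})"
    using assms(2) by (rule closed_Int[rotated])
  moreover have "pre_cell K \<omega> q e j =
      K \<inter> {p. (MIN j. e $ j + \<omega> (dist p (q j))) = e $ j + \<omega> (dist p (q j))}"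
    by (auto simp: pre_cell_def tau_def)
  ultimately show ?thesis by simp
qed

text \<open>The pre-cells are closed as coincidence sets of continuous functions, so the cells are
  Borel and the interpolant is a finite combination of their indicators.\<close>

lemma interpolant_bounded_borel:
  assumes "modulus_of_continuity \<omega>" and "closed K"
  shows "interpolant K \<omega> q e z \<in> bounded_borel K"
proof -
  have [measurable]: "pre_cell K \<omega> q e j \<in> sets borel" for j
    using pre_cell_closed[OF assms] by (rule borel_closed)
  have "cell K \<omega> q e j = pre_cell K \<omega> q e j - (\<Union>s\<in>{..<j}. pre_cell K \<omega> q e s)" for j
    by (auto simp: mem_cell_iff)
  then have cell[measurable]: "cell K \<omega> q e j \<in> sets borel" for j
    by simp
  have eq: "interpolant K \<omega> q e z p = (\<Sum>j\<in>UNIV. z $ j * indicator (cell K \<omega> q e j) p)" for p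
  proof (cases "p \<in> K")
    case True
    then obtain j where j: "p \<in> cell K \<omega> q e j" by (rule cell_exists)
    have "(\<Sum>i\<in>UNIV. z $ i * indicator (cell K \<omega> q e i) p) = (\<Sum>i\<in>UNIV. if i = j then z $ j else 0)"
    proof (rule sum.cong)
      fix i show "z $ i * indicator (cell K \<omega> q e i) p = (if i = j then z $ j else 0)"
        using j cell_unique[OF j, of i] by (cases "i = j") (auto simp: indicator_def)
    qed simp
    then show ?thesis by (simp add: interpolant_cell[OF j])
  next
    case False
    then show ?thesis by (simp add: interpolant_def mem_cell_iff pre_cell_def indicator_def)
  qed
  have "interpolant K \<omega> q e z \<in> borel_measurable borel"
    unfolding eq[abs_def] by measurable
  moreover have "bounded (range (interpolant K \<omega> q e z))"
    by (rule bounded_subset[of "insert 0 (range (\<lambda>j. z $ j))"])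
       (auto simp: interpolant_def intro: finite_imp_bounded)
  ultimately show ?thesis by (auto simp: bounded_borel_def interpolant_def)
qed

section \<open>Positive linear operators, lattice norms and the abstract recovery theorem\<close>

lemma bounded_borel_scale: "x \<in> bounded_borel K \<Longrightarrow> (\<lambda>p. c * x p) \<in> bounded_borel K"
  using bounded_scaling[of "range x" c]
  by (auto simp: bounded_borel_def image_image)

lemma bounded_borel_add:
  assumes "x \<in> bounded_borel K" "y \<in> bounded_borel K"
  shows "(\<lambda>p. x p + y p) \<in> bounded_borel K"
  using assms bounded_plus_comp[of x UNIV y] by (auto simp: bounded_borel_def)

text \<open>The conditions hold at every point instead of almost everywhere, so no measure on the
  target enters.\<close>

definition positive_linear_on :: "('a \<Rightarrow> real) set \<Rightarrow> (('a \<Rightarrow> real) \<Rightarrow> 'b \<Rightarrow> real) \<Rightarrow> bool" where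
  "positive_linear_on B A \<longleftrightarrow>
     (\<forall>x\<in>B. \<forall>y\<in>B. A (\<lambda>p. x p + y p) = (\<lambda>p. A x p + A y p)) \<and>
     (\<forall>c. \<forall>x\<in>B. A (\<lambda>p. c * x p) = (\<lambda>p. c * A x p)) \<and>
     (\<forall>x\<in>B. (\<forall>p. 0 \<le> x p) \<longrightarrow> (\<forall>p. 0 \<le> A x p))"

lemma positive_linear_onD:
  assumes "positive_linear_on B A" and "x \<in> B"
  shows "y \<in> B \<Longrightarrow> A (\<lambda>p. x p + y p) = (\<lambda>p. A x p + A y p)"
    and "A (\<lambda>p. c * x p) = (\<lambda>p. c * A x p)"
    and "(\<And>p. 0 \<le> x p) \<Longrightarrow> 0 \<le> A x r"
proof -
  note A = assms(1)[unfolded positive_linear_on_def]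
  show "y \<in> B \<Longrightarrow> A (\<lambda>p. x p + y p) = (\<lambda>p. A x p + A y p)"
    by (rule A[THEN conjunct1, rule_format, OF assms(2)])
  show "A (\<lambda>p. c * x p) = (\<lambda>p. c * A x p)"
    by (rule A[THEN conjunct2, THEN conjunct1, rule_format, OF assms(2)])
  show "(\<And>p. 0 \<le> x p) \<Longrightarrow> 0 \<le> A x r"
    by (rule A[THEN conjunct2, THEN conjunct2, rule_format, OF assms(2)])
qed

text \<open>Positivity is applied to \<open>w + y - x\<close> and \<open>w + x - y\<close>. Negation
  is written as multiplication by \<open>-1\<close> to match the homogeneity clause.\<close>

lemma positive_linear_on_abs_diff_le:
  assumes A: "positive_linear_on (bounded_borel K) A"
    and B: "x \<in> bounded_borel K" "y \<in> bounded_borel K" "w \<in> bounded_borel K"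
    and le: "\<And>p. \<bar>x p - y p\<bar> \<le> w p"
  shows "\<bar>A x r - A y r\<bar> \<le> A w r"
proof -
  have add: "A (\<lambda>p. f p + g p) = (\<lambda>p. A f p + A g p)"
    if "f \<in> bounded_borel K" "g \<in> bounded_borel K" for f g
    using that by (rule positive_linear_onD[OF A])
  have neg: "(\<lambda>p. -1 * f p) \<in> bounded_borel K" "A (\<lambda>p. -1 * f p) = (\<lambda>p. -1 * A f p)"
    if "f \<in> bounded_borel K" for f
    by (rule bounded_borel_scale[OF that] positive_linear_onD(2)[OF A that])+
  have mono: "A f r - A g r \<le> A w r"
    if f: "f \<in> bounded_borel K" and g: "g \<in> bounded_borel K" and "\<And>p. f p - g p \<le> w p" for f g
  proof -
    note gf = bounded_borel_add[OF g neg(1)[OF f]]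
    have "0 \<le> A (\<lambda>p. w p + (g p + -1 * f p)) r"
    proof (rule positive_linear_onD(3)[OF A bounded_borel_add[OF B(3) gf]])
      show "0 \<le> w p + (g p + -1 * f p)" for p using that(3)[of p] by simp
    qed
    also have "A (\<lambda>p. w p + (g p + -1 * f p)) r = A w r + (A g r + -1 * A f r)"
      by (simp only: add[OF B(3) gf] add[OF g neg(1)[OF f]] neg(2)[OF f])
    finally show ?thesis by simp
  qed
  have "x p - y p \<le> w p" "y p - x p \<le> w p" for p
    using le[of p] by auto
  then have "A x r - A y r \<le> A w r" and "A y r - A x r \<le> A w r"
    using mono[OF B(1,2)] mono[OF B(2,1)] by auto
  then show ?thesis by simp
qed

text \<open>Absolute values in \<open>Y\<close> are known only as suprema in the order of
  \<open>Y\<close>, possibly not pointwise. The universal property is enough: \<open>y\<close>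
  bounds both \<open>x\<close> and \<open>- x\<close>, hence bounds the absolute value
  \<open>a\<close> of \<open>x\<close>, and \<open>y\<close> lies below its own absolute value
  \<open>b\<close>.\<close>

lemma normed_lattice_norm_mono:
  assumes Y: "normed_lattice M Y nrm" and "x \<in> Y" "y \<in> Y"
    and le: "AE p in M. \<bar>x p\<bar> \<le> y p"
  shows "nrm x \<le> nrm y"
proof -
  have scale: "(\<lambda>p. c * f p) \<in> Y" if "f \<in> Y" for f and c :: real
    using Y that unfolding normed_lattice_def normed_space_of_functions_def by blast
  have minus: "(\<lambda>p. - f p) \<in> Y" if "f \<in> Y" for f
    using scale[OF that, of "-1"] by simp
  obtain a b where a: "is_lattice_abs M Y x a" and b: "is_lattice_abs M Y y b"
    using Y assms(2,3) minus unfolding normed_lattice_def is_lattice_abs_def by meson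
  have "ae_le M x y" "ae_le M (\<lambda>p. - x p) y"
    using le unfolding ae_le_def by (auto elim!: eventually_mono)
  then have "ae_le M a y"
    using a \<open>y \<in> Y\<close> by (auto simp: is_lattice_abs_def is_lattice_sup_def)
  moreover have "ae_le M y b"
    using b by (auto simp: is_lattice_abs_def is_lattice_sup_def)
  ultimately have "ae_le M a b"
    unfolding ae_le_def by eventually_elim auto
  with a b Y assms(2,3) show ?thesis
    unfolding normed_lattice_def by blast
qed

text \<open>Both components share one extremal pair: the pointwise error bounds of \<open>A1\<close>
  and \<open>A2\<close> add up to \<open>A \<tau>\<close>, and \<open>\<tau>\<close> is the worst
  element in both coordinates at once, so summing the operators loses nothing.\<close>

theorem optimal_recovery_positive_linear:
  fixes K1 S1 :: "'a::euclidean_space set" and K2 S2 :: "'b::euclidean_space set"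
    and q1 :: "'n1::{finite,linorder} \<Rightarrow> 'a" and q2 :: "'n2::{finite,linorder} \<Rightarrow> 'b"
    and A :: "('a \<Rightarrow> real) \<times> ('b \<Rightarrow> real) \<Rightarrow> 'x \<Rightarrow> real"
  assumes K: "compact K1" "K1 \<subseteq> S1" "compact K2" "K2 \<subseteq> S2"
    and \<omega>: "modulus_of_continuity \<omega>1" "modulus_of_continuity \<omega>2"
    and q: "range q1 \<subseteq> K1" "range q2 \<subseteq> K2"
    and e: "\<And>j. 0 \<le> e1 $ j" "\<And>j. 0 \<le> e2 $ j"
    and Y: "normed_lattice M Y nrm"
    and A1: "positive_linear_on (bounded_borel K1) A1" "A1 ` bounded_borel K1 \<subseteq> Y"
    and A2: "positive_linear_on (bounded_borel K2) A2" "A2 ` bounded_borel K2 \<subseteq> Y"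
    and A: "A = (\<lambda>(f, h) p. A1 f p + A2 h p)"
  defines "W \<equiv> H_class S1 \<omega>1 K1 \<times> H_class S2 \<omega>2 K2"
    and "I \<equiv> map_prod (info q1) (info q2)"
    and "U \<equiv> error_box e1 \<times> error_box e2"
    and "\<Phi> \<equiv> A \<circ> map_prod (interpolant K1 \<omega>1 q1 e1) (interpolant K2 \<omega>2 q2 e2)"
    and "\<tau> \<equiv> (tau K1 \<omega>1 q1 e1, tau K2 \<omega>2 q2 e2)"
  shows "range \<Phi> \<subseteq> Y"
    and "recovery_error nrm A W I U \<Phi> = ereal (nrm (A \<tau>))"
    and "optimal_error Y nrm A W I U = ereal (nrm (A \<tau>))"
proof -
  have add: "(\<lambda>p. x p + y p) \<in> Y" and nrm_add: "nrm (\<lambda>p. x p + y p) \<le> nrm x + nrm y"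
    if "x \<in> Y" "y \<in> Y" for x y
    using Y that unfolding normed_lattice_def normed_space_of_functions_def by blast+
  have scale: "(\<lambda>p. c * x p) \<in> Y" and nrm_scale: "nrm (\<lambda>p. c * x p) = \<bar>c\<bar> * nrm x"
    if "x \<in> Y" for x c
    using Y that unfolding normed_lattice_def normed_space_of_functions_def by blast+
  have diff: "(\<lambda>p. x p - y p) \<in> Y" if "x \<in> Y" "y \<in> Y" for x y
    using add[OF that(1) scale[OF that(2), of "-1"]] by simp
  have A_Y: "A (f, h) \<in> Y" if "f \<in> bounded_borel K1" "h \<in> bounded_borel K2" for f h
    using add[of "A1 f" "A2 h"] A1(2) A2(2) that by (auto simp: A)
  have H1: "x \<in> bounded_borel K1" if "x \<in> H_class S1 \<omega>1 K1" for x
    using that K(1,2) by (rule H_class_bounded_borel)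
  have H2: "x \<in> bounded_borel K2" if "x \<in> H_class S2 \<omega>2 K2" for x
    using that K(3,4) by (rule H_class_bounded_borel)
  have L1: "interpolant K1 \<omega>1 q1 e1 z \<in> bounded_borel K1" for z
    using \<omega> K by (intro interpolant_bounded_borel compact_imp_closed)
  have L2: "interpolant K2 \<omega>2 q2 e2 z \<in> bounded_borel K2" for z
    using \<omega> K by (intro interpolant_bounded_borel compact_imp_closed)
  note t = tau_in_H_class[OF \<omega>(1), of K1 q1 e1 S1] tau_in_H_class[OF \<omega>(2), of K2 q2 e2 S2]
  have tau_Y: "A \<tau> \<in> Y"
    unfolding \<tau>_def by (intro A_Y H1 H2 t)
  show range: "range \<Phi> \<subseteq> Y"
    using A_Y[OF L1 L2] by (auto simp: \<Phi>_def)
  have upper: "recovery_error nrm A W I U \<Phi> \<le> ereal (nrm (A \<tau>))"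
    unfolding recovery_error_def
  proof (intro SUP_least)
    fix x z assume "x \<in> W" and "z \<in> {I x + u |u. u \<in> U}"
    then obtain f h u v where x: "x = (f, h)" "f \<in> H_class S1 \<omega>1 K1" "h \<in> H_class S2 \<omega>2 K2"
      and z: "z = (info q1 f + u, info q2 h + v)" and uv: "u \<in> error_box e1" "v \<in> error_box e2"
      by (auto simp: W_def U_def I_def)
    have "\<bar>A x p - \<Phi> z p\<bar> \<le> A \<tau> p" for p
      using positive_linear_on_abs_diff_le[OF A1(1) H1[OF x(2)] L1 H1[OF t(1)]
          interpolant_error[OF x(2) uv(1) q(1)], of p]
        positive_linear_on_abs_diff_le[OF A2(1) H2[OF x(3)] L2 H2[OF t(2)]
          interpolant_error[OF x(3) uv(2) q(2)], of p]
      by (simp add: A \<Phi>_def x(1) z \<tau>_def abs_le_iff)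
    moreover have "(\<lambda>p. A x p - \<Phi> z p) \<in> Y"
      using range by (auto simp: x(1) intro!: diff A_Y H1 H2 x)
    ultimately show "ereal (nrm (\<lambda>p. A x p - \<Phi> z p)) \<le> ereal (nrm (A \<tau>))"
      using normed_lattice_norm_mono[OF Y _ tau_Y] by simp
  qed
  have lower: "ereal (nrm (A \<tau>)) \<le> recovery_error nrm A W I U \<Psi>" if "range \<Psi> \<subseteq> Y" for \<Psi>
  proof -
    let ?\<tau>' = "(\<lambda>p. - fst \<tau> p, \<lambda>p. - snd \<tau> p)"
    have mem: "\<tau> \<in> W" "?\<tau>' \<in> W"
      using t by (auto simp: \<tau>_def W_def intro: H_class_uminus)
    have node1: "tau K1 \<omega>1 q1 e1 (q1 j) \<le> e1 $ j" "0 \<le> tau K1 \<omega>1 q1 e1 (q1 j)" for j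
      using q(1) by (auto intro: tau_node tau_nonneg \<omega> e)
    have node2: "tau K2 \<omega>2 q2 e2 (q2 j) \<le> e2 $ j" "0 \<le> tau K2 \<omega>2 q2 e2 (q2 j)" for j
      using q(2) by (auto intro: tau_node tau_nonneg \<omega> e)
    have neg: "- e1 $ j \<le> tau K1 \<omega>1 q1 e1 (q1 j)" "- e2 $ i \<le> tau K2 \<omega>2 q2 e2 (q2 i)"
      "- tau K1 \<omega>1 q1 e1 (q1 j) \<le> e1 $ j" "- tau K2 \<omega>2 q2 e2 (q2 i) \<le> e2 $ i" for i j
      using node1(2)[of j] node2(2)[of i] e(1)[of j] e(2)[of i] by linarith+
    \<comment> \<open>The error vector that cancels the information is admissible because the values
      of \<open>tau\<close> at the nodes lie between 0 and the error bounds.\<close>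
    have "- I \<tau> \<in> U" "- I ?\<tau>' \<in> U"
      using node1 node2 neg by (auto simp: I_def U_def \<tau>_def error_box_def info_def)
    then have zero: "0 \<in> {I \<tau> + u |u. u \<in> U}" "0 \<in> {I ?\<tau>' + u |u. u \<in> U}"
      by (metis (mono_tags, lifting) CollectI right_minus)+
    let ?R = "recovery_error nrm A W I U \<Psi>"
    have err: "ereal (nrm (\<lambda>p. A x p - \<Psi> 0 p)) \<le> ?R"
      if "x \<in> W" "0 \<in> {I x + u |u. u \<in> U}" for x
      unfolding recovery_error_def by (rule SUP_upper2[OF that(1)], rule SUP_upper2[OF that(2)]) simp
    have A_neg: "A ?\<tau>' = (\<lambda>p. -1 * A \<tau> p)"
    proof -
      have "A1 (\<lambda>p. -1 * fst \<tau> p) = (\<lambda>p. -1 * A1 (fst \<tau>) p)"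
        unfolding \<tau>_def fst_conv by (rule positive_linear_onD(2)[OF A1(1) H1[OF t(1)]])
      moreover have "A2 (\<lambda>p. -1 * snd \<tau> p) = (\<lambda>p. -1 * A2 (snd \<tau>) p)"
        unfolding \<tau>_def snd_conv by (rule positive_linear_onD(2)[OF A2(1) H2[OF t(2)]])
      ultimately show ?thesis by (simp add: A \<tau>_def fun_eq_iff)
    qed
    have \<Psi>: "\<Psi> 0 \<in> Y" using that by auto
    let ?a = "nrm (\<lambda>p. A \<tau> p - \<Psi> 0 p)" and ?b = "nrm (\<lambda>p. A ?\<tau>' p - \<Psi> 0 p)"
    have Y2: "(\<lambda>p. A \<tau> p - \<Psi> 0 p) \<in> Y" "(\<lambda>p. A ?\<tau>' p - \<Psi> 0 p) \<in> Y"
      unfolding A_neg by (intro diff scale tau_Y \<Psi>)+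
    \<comment> \<open>The method gives the same answer \<open>\<Psi> 0\<close> to both elements, so
      it cancels in the difference of the two errors. The larger error is then at least half the
      norm of that difference.\<close>
    have "2 * nrm (A \<tau>) = nrm (\<lambda>p. 2 * A \<tau> p)"
      using nrm_scale[OF tau_Y, of 2] by simp
    also have "\<dots> = nrm (\<lambda>p. (A \<tau> p - \<Psi> 0 p) + -1 * (A ?\<tau>' p - \<Psi> 0 p))"
      unfolding A_neg by (simp add: algebra_simps)
    also have "\<dots> \<le> ?a + nrm (\<lambda>p. -1 * (A ?\<tau>' p - \<Psi> 0 p))"
      by (intro nrm_add scale Y2)
    also have "nrm (\<lambda>p. -1 * (A ?\<tau>' p - \<Psi> 0 p)) = ?b"
      using nrm_scale[OF Y2(2), of "-1"] by simp
    finally have "nrm (A \<tau>) \<le> max ?a ?b" by (simp add: max_def)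
    also have "ereal (max ?a ?b) \<le> ?R"
      using err[OF mem(1) zero(1)] err[OF mem(2) zero(2)] by (simp add: max_def)
    finally show ?thesis by simp
  qed
  show "recovery_error nrm A W I U \<Phi> = ereal (nrm (A \<tau>))"
    using upper lower[OF range] by (rule antisym)
  show "optimal_error Y nrm A W I U = ereal (nrm (A \<tau>))"
    unfolding optimal_error_def
  proof (rule antisym)
    show "(INF \<Phi>\<in>{\<Phi>. range \<Phi> \<subseteq> Y}. recovery_error nrm A W I U \<Phi>) \<le> ereal (nrm (A \<tau>))"
      using upper range by (intro INF_lower2[of \<Phi>]) auto
    show "ereal (nrm (A \<tau>)) \<le> (INF \<Phi>\<in>{\<Phi>. range \<Phi> \<subseteq> Y}. recovery_error nrm A W I U \<Phi>)"
      using lower by (intro INF_greatest) auto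
  qed
qed

section \<open>Integrability of the kernels\<close>

text \<open>In the variable \<open>norm v ^ DIM('a)\<close> the radial part of Lebesgue measure is uniform, which
  turns both kernels into powers on an interval.\<close>

lemma distr_norm_power:
  fixes u :: "'a::euclidean_space"
  shows "distr lborel borel (\<lambda>v. norm (u - v) ^ DIM('a)) =
    density lborel (\<lambda>y. ennreal (unit_ball_vol (DIM('a))) * indicator {0..} y)"
    (is "?D = ?E")
proof (rule measure_eqI_generator_eq)
  let ?n = "DIM('a)" and ?\<kappa> = "unit_ball_vol (DIM('a))"
  show "Int_stable (range (lessThan :: real \<Rightarrow> real set))"
  proof (rule Int_stableI_image)
    show "\<exists>k\<in>UNIV. {..<x} \<inter> {..<y} = {..<k}" for x y :: real
      by (intro bexI[of _ "min x y"]) auto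
  qed
  show "range lessThan \<subseteq> Pow (UNIV :: real set)" by auto
  have borel: "sets borel = sigma_sets UNIV (range (lessThan :: real \<Rightarrow> real set))"
    by (subst borel_eq_lessThan) (simp add: eucl_less_def lessThan_def)
  show "sets ?D = sigma_sets UNIV (range lessThan)" "sets ?E = sigma_sets UNIV (range lessThan)"
    using borel by simp_all
  have D: "emeasure ?D {..<y} = ennreal (?\<kappa> * max 0 y)" for y
  proof (cases "0 < y")
    case True
    \<comment> \<open>A ball of radius \<open>root ?n y\<close> has volume proportional to
      \<open>y\<close>; this linearity is why the image measure is uniform.\<close>
    have "(\<lambda>v. norm (u - v) ^ ?n) -` {..<y} \<inter> space lborel = ball u (root ?n y)"
    proof (safe; clarsimp simp: dist_norm)
      fix v assume "norm (u - v) ^ ?n < y"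
      then have "root ?n (norm (u - v) ^ ?n) < root ?n y" by (subst real_root_less_iff) auto
      then show "norm (u - v) < root ?n y" by (simp add: real_root_power_cancel)
    next
      fix v assume "norm (u - v) < root ?n y"
      then have "norm (u - v) ^ ?n < root ?n y ^ ?n" by (intro power_strict_mono) auto
      then show "norm (u - v) ^ ?n < y" using True by simp
    qed
    with True show ?thesis by (simp add: emeasure_distr emeasure_ball max_def)
  next
    case False
    have "\<not> norm (u - v) ^ ?n < y" for v
      using False zero_le_power[OF norm_ge_zero, of "u - v" ?n] by linarith
    then have "(\<lambda>v. norm (u - v) ^ ?n) -` {..<y} = {}" by auto
    then show ?thesis using False by (simp add: emeasure_distr max_def)
  qed
  have E: "emeasure ?E {..<y} = ennreal (?\<kappa> * max 0 y)" for y
  proof -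
    have "emeasure ?E {..<y} = (\<integral>\<^sup>+ x. ennreal ?\<kappa> * indicator {0..<y} x \<partial>lborel)"
      by (auto simp: emeasure_density indicator_def intro!: nn_integral_cong)
    also have "\<dots> = ennreal ?\<kappa> * emeasure lborel {0..<y}" by (simp add: nn_integral_cmult)
    also have "\<dots> = ennreal (?\<kappa> * max 0 y)"
      by (cases "0 \<le> y") (auto simp: ennreal_mult max_def)
    finally show ?thesis .
  qed
  show "emeasure ?D X = emeasure ?E X" if "X \<in> range lessThan" for X
    using that D E by auto
  show "range (\<lambda>i. {..<real i}) \<subseteq> range lessThan" by auto
  show "(\<Union>i. {..<real i}) = UNIV" by (auto intro: reals_Archimedean2)
  show "emeasure ?D {..<real i} \<noteq> \<infinity>" for i by (simp add: D)
qed

lemma nn_integral_norm_power: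
  fixes u :: "'a::euclidean_space"
  assumes [measurable]: "g \<in> borel_measurable borel"
  shows "(\<integral>\<^sup>+ v. g (norm (u - v) ^ DIM('a)) \<partial>lborel) =
    ennreal (unit_ball_vol (DIM('a))) * (\<integral>\<^sup>+ y. g y * indicator {0..} y \<partial>lborel)"
proof -
  have "(\<integral>\<^sup>+ v. g (norm (u - v) ^ DIM('a)) \<partial>lborel) =
      (\<integral>\<^sup>+ y. g y \<partial>distr lborel borel (\<lambda>v. norm (u - v) ^ DIM('a)))"
    by (simp add: nn_integral_distr)
  also have "\<dots> = (\<integral>\<^sup>+ y. ennreal (unit_ball_vol (DIM('a))) * (g y * indicator {0..} y) \<partial>lborel)"
    unfolding distr_norm_power
    by (subst nn_integral_density) (auto intro!: nn_integral_cong simp: mult_ac)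
  finally show ?thesis by (simp add: nn_integral_cmult)
qed

lemma nn_integral_powr_neg:
  assumes "0 \<le> c" "-1 < a"
  shows "(\<integral>\<^sup>+ y. ennreal (y powr a) * indicator {0..c} y \<partial>lborel) = ennreal (c powr (a + 1) / (a + 1))"
  using has_integral_powr_from_0[OF assms(2,1)] by (intro nn_integral_has_integral_lebesgue') auto

text \<open>The variable \<open>y = (norm (u - v))^2\<close> has constant density \<open>pi\<close>,
  which leaves the integral of \<open>1 / sqrt (s^2 - y)\<close> over
  \<open>0 \<le> y < s^2\<close>, equal to \<open>2 * s\<close>.\<close>

lemma nn_integral_inverse_sqrt_ball:
  fixes u :: "'a::euclidean_space"
  assumes "DIM('a) = 2" and "0 \<le> s"
  shows "(\<integral>\<^sup>+ v. ennreal (1 / sqrt (s\<^sup>2 - (norm (u - v))\<^sup>2)) * indicator (ball u s) v \<partial>lborel)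
    = ennreal (2 * pi * s)"
proof -
  define g where "g y = ennreal (1 / sqrt (s\<^sup>2 - y)) * indicator {..<s\<^sup>2} y" for y
  have [measurable]: "g \<in> borel_measurable borel" unfolding g_def by measurable
  have "norm (u - v) < s \<longleftrightarrow> (norm (u - v))\<^sup>2 < s\<^sup>2" for v
    using assms(2) by (metis norm_ge_zero power2_less_imp_less power_strict_mono zero_less_numeral)
  then have "(\<integral>\<^sup>+ v. ennreal (1 / sqrt (s\<^sup>2 - (norm (u - v))\<^sup>2)) * indicator (ball u s) v \<partial>lborel)
      = (\<integral>\<^sup>+ v. g (norm (u - v) ^ DIM('a)) \<partial>lborel)"
    by (intro nn_integral_cong) (simp add: g_def assms(1) dist_norm indicator_def)
  also have "\<dots> = ennreal pi * (\<integral>\<^sup>+ y. g y * indicator {0..} y \<partial>lborel)"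
    by (subst nn_integral_norm_power) (simp_all add: assms(1) unit_ball_vol_2)
  \<comment> \<open>The reflection of \<open>y\<close> to \<open>s^2 - y\<close> moves the
    singularity from the rim to 0.\<close>
  also have "(\<integral>\<^sup>+ y. g y * indicator {0..} y \<partial>lborel) =
      (\<integral>\<^sup>+ y. g (s\<^sup>2 - y) * indicator {0..} (s\<^sup>2 - y) \<partial>lborel)"
    by (subst nn_integral_real_affine[where c = "-1" and t = "s\<^sup>2"]) simp_all
  also have "\<dots> = (\<integral>\<^sup>+ y. ennreal (y powr (-1/2)) * indicator {0..s\<^sup>2} y \<partial>lborel)"
  proof (intro nn_integral_cong)
    fix y :: real
    show "g (s\<^sup>2 - y) * indicator {0..} (s\<^sup>2 - y) = ennreal (y powr (-1/2)) * indicator {0..s\<^sup>2} y"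
    proof (cases "0 < y")
      case True
      then have "y powr (-1/2) = 1 / sqrt y"
        using powr_minus_divide[of y "1/2"] by (simp add: powr_half_sqrt)
      with True show ?thesis by (simp add: g_def indicator_def)
    next
      \<comment> \<open>At \<open>y = 0\<close> the half-open cut-off in \<open>g\<close> agrees
        with the convention that 0 to any real power is 0.\<close>
      case False
      then show ?thesis by (cases "y = 0") (simp_all add: g_def indicator_def)
    qed
  qed
  also have "\<dots> = ennreal (2 * s)"
    using assms(2) by (subst nn_integral_powr_neg) (simp_all add: powr_half_sqrt)
  finally show ?thesis
    by (simp add: ennreal_mult'[symmetric] mult_ac)
qed

text \<open>In the variable \<open>y = norm (u - v) ^ 3\<close> the kernel is
  \<open>y powr (-1/3)\<close>, and an exponent above -1 is integrable at 0. The centre is harmless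
  because \<open>1 / 0 = 0\<close>.\<close>

lemma nn_integral_inverse_norm_ball:
  fixes u :: "'a::euclidean_space"
  assumes "DIM('a) = 3" and "0 \<le> t"
  shows "(\<integral>\<^sup>+ v. ennreal (1 / norm (u - v)) * indicator (ball u t) v \<partial>lborel) < \<infinity>"
proof -
  define g where "g y = ennreal (y powr (-1/3)) * indicator {0..t ^ 3} y" for y
  have [measurable]: "g \<in> borel_measurable borel" unfolding g_def by measurable
  have "(\<integral>\<^sup>+ v. ennreal (1 / norm (u - v)) * indicator (ball u t) v \<partial>lborel)
      \<le> (\<integral>\<^sup>+ v. g (norm (u - v) ^ DIM('a)) \<partial>lborel)"
  proof (intro nn_integral_mono)
    fix v
    show "ennreal (1 / norm (u - v)) * indicator (ball u t) v \<le> g (norm (u - v) ^ DIM('a))"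
    proof (cases "u \<noteq> v \<and> norm (u - v) < t")
      case True
      then have "norm (u - v) ^ 3 \<le> t ^ 3" by (intro power_mono) auto
      moreover have "(norm (u - v) ^ 3) powr (-1/3) = 1 / norm (u - v)"
      proof -
        have "0 < norm (u - v)" using True by simp
        then have "(norm (u - v) ^ 3) powr (-1/3) = (norm (u - v) powr 3) powr (-1/3)" by simp
        also have "\<dots> = norm (u - v) powr (-1)" unfolding powr_powr by simp
        also have "\<dots> = 1 / norm (u - v)" by (simp add: powr_neg_one)
        finally show ?thesis .
      qed
      ultimately show ?thesis using True by (simp add: g_def assms(1) dist_norm)
    next
      case False
      then show ?thesis by (auto simp: dist_norm indicator_def)
    qed
  qed
  also have "\<dots> = ennreal (unit_ball_vol (DIM('a))) * (\<integral>\<^sup>+ y. g y * indicator {0..} y \<partial>lborel)"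
    by (rule nn_integral_norm_power) simp
  also have "(\<integral>\<^sup>+ y. g y * indicator {0..} y \<partial>lborel) = (\<integral>\<^sup>+ y. g y \<partial>lborel)"
    by (intro nn_integral_cong) (auto simp: g_def indicator_def)
  also have "(\<integral>\<^sup>+ y. g y \<partial>lborel) = ennreal ((t ^ 3) powr (-1/3 + 1) / (-1/3 + 1))"
    unfolding g_def using assms(2) by (intro nn_integral_powr_neg) simp_all
  also have "ennreal (unit_ball_vol (DIM('a))) * \<dots> < \<infinity>"
    by (simp add: ennreal_mult_less_top)
  finally show ?thesis .
qed

section \<open>Finiteness of the surface measure of spheres\<close>

text \<open>The balls of radius \<open>r / 2\<close> about the points of \<open>F\<close> are disjoint subsets of a spherical
  shell of volume \<open>O(r)\<close>.\<close>

lemma separated_sphere_card: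
  fixes u :: "'a::euclidean_space" and r t :: real
  assumes r: "0 < r" "r \<le> t" and F: "finite F" "F \<subseteq> sphere u t"
    and sep: "\<And>x y. x \<in> F \<Longrightarrow> y \<in> F \<Longrightarrow> x \<noteq> y \<Longrightarrow> r \<le> dist x y"
  shows "real (card F) * (r / 2) ^ DIM('a) \<le> r * (DIM('a) * (2 * t) ^ (DIM('a) - 1))"
proof -
  let ?n = "DIM('a)" and ?\<kappa> = "unit_ball_vol (DIM('a))"
  have \<kappa>: "0 < ?\<kappa>" by simp
  have disj: "disjoint_family_on (\<lambda>x. ball x (r / 2)) F"
    unfolding disjoint_family_on_def
  proof (intro ballI impI equals0I)
    fix x y z assume xy: "x \<in> F" "y \<in> F" "x \<noteq> y" and "z \<in> ball x (r / 2) \<inter> ball y (r / 2)"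
    then have "dist x y < r" using dist_triangle2[of x y z] by simp
    with sep[OF xy] show False by simp
  qed
  have "(\<Union>x\<in>F. ball x (r / 2)) \<subseteq> ball u (t + r / 2) - ball u (t - r / 2)"
  proof
    fix z assume "z \<in> (\<Union>x\<in>F. ball x (r / 2))"
    then obtain x where x: "x \<in> F" "dist x z < r / 2" by auto
    then have "dist u x = t" using F(2) by auto
    with x(2) show "z \<in> ball u (t + r / 2) - ball u (t - r / 2)"
      using dist_triangle[of u z x] dist_triangle[of u x z] by (simp add: dist_commute)
  qed
  then have "measure lborel (\<Union>x\<in>F. ball x (r / 2))
      \<le> measure lborel (ball u (t + r / 2) - ball u (t - r / 2))"
    by (intro measure_mono_fmeasurable fmeasurable_Diff sets.finite_UN F fmeasurableI
      emeasure_lborel_ball_finite) auto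
  also have "\<dots> = ?\<kappa> * ((t + r / 2) ^ ?n - (t - r / 2) ^ ?n)"
    using r emeasure_lborel_ball_finite[of u "t + r / 2"]
    by (subst measure_Diff) (auto simp: content_ball algebra_simps)
  \<comment> \<open>The difference of powers contains the factor \<open>r\<close>, the thickness of
    the shell. In the cofactor both bases lie between 0 and \<open>2 * t\<close> because
    \<open>r \<le> t\<close>.\<close>
  also have "(t + r / 2) ^ ?n - (t - r / 2) ^ ?n \<le> r * (?n * (2 * t) ^ (?n - 1))"
  proof -
    have "(t + r / 2) ^ ?n - (t - r / 2) ^ ?n =
        r * (\<Sum>i<?n. (t - r / 2) ^ (?n - Suc i) * (t + r / 2) ^ i)"
      by (subst power_diff_sumr2) simp
    also have "(\<Sum>i<?n. (t - r / 2) ^ (?n - Suc i) * (t + r / 2) ^ i) \<le> (\<Sum>i<?n. (2 * t) ^ (?n - 1))"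
    proof (rule sum_mono)
      fix i assume i: "i \<in> {..<?n}"
      have "(t - r / 2) ^ (?n - Suc i) * (t + r / 2) ^ i \<le> (2 * t) ^ (?n - Suc i) * (2 * t) ^ i"
        using r by (intro mult_mono power_mono) auto
      also have "\<dots> = (2 * t) ^ (?n - 1)" using i unfolding power_add[symmetric] by simp
      finally show "(t - r / 2) ^ (?n - Suc i) * (t + r / 2) ^ i \<le> (2 * t) ^ (?n - 1)" .
    qed
    finally show ?thesis using r by simp
  qed
  finally have "measure lborel (\<Union>x\<in>F. ball x (r / 2)) \<le> ?\<kappa> * (r * (?n * (2 * t) ^ (?n - 1)))"
    using \<kappa> by simp
  moreover have "measure lborel (\<Union>x\<in>F. ball x (r / 2)) = (\<Sum>x\<in>F. measure lborel (ball x (r / 2)))"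
    using emeasure_lborel_ball_finite[of _ "r / 2"]
    by (intro measure_finite_Union[OF F(1) _ disj]) (auto simp: less_top)
  moreover have "\<dots> = ?\<kappa> * (card F * (r / 2) ^ ?n)"
    using r by (simp add: content_ball)
  ultimately show ?thesis using \<kappa> by simp
qed

text \<open>A separated set of greatest cardinality must cover: a point farther than
  \<open>r\<close> from all its members could be added.\<close>

lemma maximal_separated_set:
  fixes S :: "'a::metric_space set"
  assumes "\<And>F. finite F \<Longrightarrow> F \<subseteq> S \<Longrightarrow> (\<And>x y. x \<in> F \<Longrightarrow> y \<in> F \<Longrightarrow> x \<noteq> y \<Longrightarrow> r \<le> dist x y)
      \<Longrightarrow> card F \<le> m" and "0 \<le> r"
  obtains F where "finite F" "F \<subseteq> S"
    and "\<And>x y. x \<in> F \<Longrightarrow> y \<in> F \<Longrightarrow> x \<noteq> y \<Longrightarrow> r \<le> dist x y" and "S \<subseteq> (\<Union>x\<in>F. cball x r)"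
proof -
  define P where "P F \<longleftrightarrow> finite F \<and> F \<subseteq> S \<and> (\<forall>x\<in>F. \<forall>y\<in>F. x \<noteq> y \<longrightarrow> r \<le> dist x y)" for F
  have "\<exists>F. P F \<and> (\<forall>G. P G \<longrightarrow> card G \<le> card F)"
  proof (rule ex_has_greatest_nat)
    show "P {}" by (simp add: P_def)
    show "\<forall>G. P G \<longrightarrow> card G < Suc m" using assms(1) by (simp add: P_def less_Suc_eq_le)
  qed
  then obtain F where F: "P F" and max: "\<forall>G. P G \<longrightarrow> card G \<le> card F" by blast
  have "S \<subseteq> (\<Union>x\<in>F. cball x r)"
  proof (rule ccontr)
    assume "\<not> S \<subseteq> (\<Union>x\<in>F. cball x r)"
    then obtain z where z: "z \<in> S" "z \<notin> (\<Union>x\<in>F. cball x r)" by blast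
    then have far: "r < dist x z" if "x \<in> F" for x using that by fastforce
    then have "z \<notin> F" using assms(2) by fastforce
    have "P (insert z F)" using F z(1) far by (auto simp: P_def dist_commute less_imp_le)
    with max have "card (insert z F) \<le> card F" by blast
    with \<open>z \<notin> F\<close> F show False by (simp add: P_def)
  qed
  with F show ?thesis by (intro that[of F]) (auto simp: P_def)
qed

lemma hausdorff_content_finite_cover:
  fixes S :: "'a::euclidean_space set"
  assumes "finite F" and "S \<subseteq> (\<Union>x\<in>F. cball x r)" and "0 \<le> r" "2 * r \<le> \<delta>"
  shows "hausdorff_content k \<delta> S \<le> ennreal (card F * (unit_ball_vol (real k) * r ^ k))"
proof -
  obtain h where h: "bij_betw h {..<card F} F"
    using ex_bij_betw_nat_finite[OF assms(1)] by (auto simp: atLeast0LessThan)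
  \<comment> \<open>The finite cover is padded to a sequence by empty sets, whose weight is 0 even
    for \<open>k = 0\<close>.\<close>
  define C where "C i = (if i < card F then cball (h i) r else {})" for i
  have "S \<subseteq> (\<Union>i. C i)"
  proof
    fix z assume "z \<in> S"
    then obtain x where "x \<in> F" "z \<in> cball x r" using assms(2) by auto
    moreover obtain i where "i < card F" "h i = x"
      using h \<open>x \<in> F\<close> by (metis bij_betw_iff_bijections lessThan_iff)
    ultimately show "z \<in> (\<Union>i. C i)" by (auto simp: C_def)
  qed
  moreover have "bounded (C i) \<and> diameter (C i) \<le> \<delta>" for i
    using assms(3,4) by (simp add: C_def)
  ultimately have "hausdorff_content k \<delta> S \<le> (\<Sum>i. hausdorff_weight k (C i))"
    unfolding hausdorff_content_def by (intro INF_lower) auto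
  also have "\<dots> = (\<Sum>i<card F. hausdorff_weight k (C i))"
    by (intro suminf_finite) (auto simp: C_def hausdorff_weight_def)
  also have "\<dots> = (\<Sum>i<card F. ennreal (unit_ball_vol (real k) * r ^ k))"
    using assms(3) by (intro sum.cong) (auto simp: C_def hausdorff_weight_def)
  also have "\<dots> = ennreal (card F * (unit_ball_vol (real k) * r ^ k))"
    using assms(3) by (simp add: ennreal_mult ennreal_of_nat_eq_real_of_nat)
  finally show ?thesis .
qed

text \<open>A packing of the sphere has \<open>O(r^(-k))\<close> points and each covering ball costs
  a constant times \<open>r^k\<close>, so the product is bounded independently of the scale.\<close>

lemma hausdorff_outer_measure_sphere_finite:
  fixes u :: "'a::euclidean_space"
  assumes "DIM('a) = Suc k" and t: "0 < t"
  shows "hausdorff_outer_measure k (sphere u t) < \<infinity>"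
proof -
  \<comment> \<open>The packing bound in dimension \<open>Suc k\<close>, divided by one factor
    \<open>r\<close> and cleared of the powers of 2 from the radius \<open>r / 2\<close>, times the
    volume of the unit ball.\<close>
  define B where "B = unit_ball_vol (real k) * (2 ^ Suc k * (Suc k * (2 * t) ^ k))"
  have "hausdorff_content k \<delta> (sphere u t) \<le> ennreal B" if "0 < \<delta>" for \<delta>
  proof -
    \<comment> \<open>The bound \<open>t\<close> is required by the packing estimate;
      \<open>\<delta> / 2\<close> keeps the diameters \<open>2 * r\<close> of the covering balls
      below \<open>\<delta>\<close>.\<close>
    define r where "r = min t (\<delta> / 2)"
    have r: "0 < r" "r \<le> t" "2 * r \<le> \<delta>" using t that by (auto simp: r_def)
    have card: "card F * r ^ k \<le> 2 ^ Suc k * (Suc k * (2 * t) ^ k)"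
      if "finite F" "F \<subseteq> sphere u t" "\<And>x y. x \<in> F \<Longrightarrow> y \<in> F \<Longrightarrow> x \<noteq> y \<Longrightarrow> r \<le> dist x y" for F
    proof -
      have "card F * (r / 2) ^ Suc k \<le> r * (Suc k * (2 * t) ^ k)"
        using separated_sphere_card[OF r(1,2) that] by (simp add: assms(1))
      then have "r * (card F * r ^ k) \<le> r * (2 ^ Suc k * (Suc k * (2 * t) ^ k))"
        by (simp add: power_divide field_simps)
      then show ?thesis using r(1) by (simp only: mult_le_cancel_left_pos)
    qed
    have "card F \<le> nat \<lfloor>2 ^ Suc k * (Suc k * (2 * t) ^ k) / r ^ k\<rfloor>"
      if "finite F" "F \<subseteq> sphere u t" "\<And>x y. x \<in> F \<Longrightarrow> y \<in> F \<Longrightarrow> x \<noteq> y \<Longrightarrow> r \<le> dist x y" for F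
      using card[OF that] r(1) by (intro le_nat_floor) (simp add: pos_le_divide_eq)
    then obtain F where F: "finite F" "F \<subseteq> sphere u t"
      "\<And>x y. x \<in> F \<Longrightarrow> y \<in> F \<Longrightarrow> x \<noteq> y \<Longrightarrow> r \<le> dist x y" and cover: "sphere u t \<subseteq> (\<Union>x\<in>F. cball x r)"
      using r(1) by (elim maximal_separated_set) auto
    have "hausdorff_content k \<delta> (sphere u t) \<le> ennreal (card F * (unit_ball_vol (real k) * r ^ k))"
      using r by (intro hausdorff_content_finite_cover F(1) cover) auto
    also have "card F * (unit_ball_vol (real k) * r ^ k) = unit_ball_vol (real k) * (card F * r ^ k)"
      by simp
    also have "\<dots> \<le> B"
      unfolding B_def by (intro mult_left_mono card F) auto
    finally show ?thesis by (simp add: ennreal_leI)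
  qed
  then have "hausdorff_outer_measure k (sphere u t) \<le> ennreal B"
    unfolding hausdorff_outer_measure_def by (intro SUP_least) auto
  then show ?thesis by (simp add: le_less_trans)
qed

lemma sets_hausdorff_measure [simp]: "sets (hausdorff_measure k) = sets borel"
  using sets.sigma_sets_eq[of borel] by (simp add: hausdorff_measure_def)

text \<open>An inequality suffices: \<open>measure_of\<close> yields the zero measure if the given set function
  is not a measure, so countable additivity of the Hausdorff measure need not be proved.\<close>

lemma emeasure_hausdorff_sphere_finite:
  fixes u :: "'a::euclidean_space"
  assumes "DIM('a) = Suc k" and "0 < t"
  shows "emeasure (hausdorff_measure k) (sphere u t) < \<infinity>"
proof -
  have "emeasure (hausdorff_measure k) (sphere u t) \<le> hausdorff_outer_measure k (sphere u t)"
    unfolding hausdorff_measure_def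
    by (subst emeasure_measure_of_conv) (simp add: sets.sigma_sets_eq)
  also have "\<dots> < \<infinity>" by (rule hausdorff_outer_measure_sphere_finite[OF assms])
  finally show ?thesis .
qed

section \<open>Positivity and linearity of the solution operators\<close>

lemma set_integrable_bounded_mult:
  fixes f w :: "'a \<Rightarrow> real"
  assumes "set_integrable M A w" and f: "f \<in> borel_measurable M" "bounded (range f)"
  shows "set_integrable M A (\<lambda>x. f x * w x)"
proof -
  obtain C where C: "\<And>x. \<bar>f x\<bar> \<le> C" using f(2) by (auto simp: bounded_iff)
  have "integrable M (\<lambda>x. indicator A x *\<^sub>R w x)" using assms(1) by (simp add: set_integrable_def)
  then have "integrable M (\<lambda>x. C * (indicator A x *\<^sub>R w x))" by simp
  then have "integrable M (\<lambda>x. f x * (indicator A x *\<^sub>R w x))"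
  proof (rule Bochner_Integration.integrable_bound)
    show "(\<lambda>x. f x * (indicator A x *\<^sub>R w x)) \<in> borel_measurable M"
      using f(1) \<open>integrable M (\<lambda>x. indicator A x *\<^sub>R w x)\<close> by measurable
    show "AE x in M. norm (f x * (indicator A x *\<^sub>R w x)) \<le> norm (C * (indicator A x *\<^sub>R w x))"
    proof (rule AE_I2)
      fix x
      have "\<bar>f x\<bar> \<le> \<bar>C\<bar>" using C[of x] by simp
      then show "norm (f x * (indicator A x *\<^sub>R w x)) \<le> norm (C * (indicator A x *\<^sub>R w x))"
        unfolding real_norm_def abs_mult by (rule mult_right_mono) simp
    qed
  qed
  then show ?thesis by (simp add: set_integrable_def mult_ac)
qed

text \<open>Negative radii are included, with empty balls, because the operators are treated at all
  real times. The exact value will bound the inner integral of the Poisson source term.\<close>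

lemma set_integrable_inverse_sqrt_ball:
  fixes u :: "'a::euclidean_space"
  assumes "DIM('a) = 2"
  shows "set_integrable lborel (ball u s) (\<lambda>v. 1 / sqrt (s\<^sup>2 - (norm (u - v))\<^sup>2))"
    and "0 \<le> s \<Longrightarrow> (LINT v:ball u s|lborel. 1 / sqrt (s\<^sup>2 - (norm (u - v))\<^sup>2)) = 2 * pi * s"
proof -
  let ?w = "\<lambda>s v. 1 / sqrt (s\<^sup>2 - (norm (u - v))\<^sup>2)"
  have nonneg: "0 \<le> indicator (ball u s) v *\<^sub>R ?w s v" for s v
    by (auto simp: indicator_def dist_norm power_strict_mono less_imp_le intro!: power_mono)
  have meas: "(\<lambda>v. indicator (ball u s) v *\<^sub>R ?w s v) \<in> borel_measurable lborel" for s
    by (intro borel_measurable_scaleR borel_measurable_indicator) measurable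
  have nn: "(\<integral>\<^sup>+ v. ennreal (indicator (ball u s) v *\<^sub>R ?w s v) \<partial>lborel) = ennreal (2 * pi * s)"
    if "0 \<le> s" for s
    unfolding nn_integral_inverse_sqrt_ball[OF assms that, of u, symmetric]
    by (intro nn_integral_cong) (auto simp: indicator_def)
  show "set_integrable lborel (ball u s) (?w s)"
  proof (cases "0 \<le> s")
    case True
    show ?thesis
      unfolding set_integrable_def
      using nonneg nn[OF True] by (intro integrableI_nonneg meas) auto
  next
    case False
    then have empty: "ball u s = {}" by simp
    show ?thesis unfolding set_integrable_def empty by simp
  qed
  show "(LINT v:ball u s|lborel. ?w s v) = 2 * pi * s" if "0 \<le> s"
    unfolding set_lebesgue_integral_def
    using nonneg nn[OF that] that by (subst integral_eq_nn_integral[OF meas]) auto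
qed

lemma set_integrable_inverse_norm_ball:
  fixes u :: "'a::euclidean_space"
  assumes "DIM('a) = 3"
  shows "set_integrable lborel (ball u t) (\<lambda>v. 1 / norm (u - v))"
proof (cases "0 \<le> t")
  case True
  have "(\<integral>\<^sup>+ v. ennreal (indicator (ball u t) v *\<^sub>R (1 / norm (u - v))) \<partial>lborel)
      = (\<integral>\<^sup>+ v. ennreal (1 / norm (u - v)) * indicator (ball u t) v \<partial>lborel)"
    by (intro nn_integral_cong) (auto simp: indicator_def)
  moreover have "(\<lambda>v. indicator (ball u t) v *\<^sub>R (1 / norm (u - v))) \<in> borel_measurable lborel"
    by (intro borel_measurable_scaleR borel_measurable_indicator) measurable
  ultimately show ?thesis
    unfolding set_integrable_def using nn_integral_inverse_norm_ball[OF assms True, of u]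
    by (intro integrableI_nonneg) auto
next
  case False
  then have empty: "ball u t = {}" by simp
  show ?thesis unfolding set_integrable_def empty by simp
qed

text \<open>Integrability is only required where \<open>c y \<noteq> 0\<close>, which excludes the degenerate times \<open>t \<le> 0\<close> of
  the Kirchhoff formula.\<close>

lemma positive_linear_on_integral:
  assumes c: "\<And>y. 0 \<le> c y"
    and int: "\<And>y. c y \<noteq> 0 \<Longrightarrow> set_integrable (M y) (S y) (\<lambda>x. 1 / w y x)"
    and w: "\<And>x y. x \<in> S y \<Longrightarrow> 0 \<le> w y x"
    and meas: "\<And>f y. f \<in> B \<Longrightarrow> (\<lambda>x. f (\<kappa> y x)) \<in> borel_measurable (M y)"
    and bdd: "\<And>f. f \<in> B \<Longrightarrow> bounded (range f)"
  shows "positive_linear_on B (\<lambda>f y. c y * (LINT x:S y|M y. f (\<kappa> y x) / w y x))"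
  unfolding positive_linear_on_def
proof (intro conjI ballI allI impI ext)
  have integrable: "set_integrable (M y) (S y) (\<lambda>x. f (\<kappa> y x) / w y x)" if "f \<in> B" "c y \<noteq> 0" for f y
  proof -
    have "bounded (range (\<lambda>x. f (\<kappa> y x)))"
      by (rule bounded_subset[OF bdd[OF that(1)]]) auto
    from set_integrable_bounded_mult[OF int[OF that(2)] meas[OF that(1)] this]
    show ?thesis by simp
  qed
  show "c y * (LINT x:S y|M y. (f (\<kappa> y x) + g (\<kappa> y x)) / w y x) =
      c y * (LINT x:S y|M y. f (\<kappa> y x) / w y x) + c y * (LINT x:S y|M y. g (\<kappa> y x) / w y x)"
    if "f \<in> B" "g \<in> B" for f g y
    using that integrable[of f y] integrable[of g y]
    by (cases "c y = 0") (simp_all add: add_divide_distrib algebra_simps)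
  \<comment> \<open>Scaling commutes with the integral unconditionally; only additivity calls on
    integrability.\<close>
  show "c y * (LINT x:S y|M y. a * f (\<kappa> y x) / w y x) = a * (c y * (LINT x:S y|M y. f (\<kappa> y x) / w y x))"
    for a f y
    using set_integral_mult_right[where A = "S y" and M = "M y" and f = "\<lambda>x. f (\<kappa> y x) / w y x"] by simp
  show "0 \<le> c y * (LINT x:S y|M y. f (\<kappa> y x) / w y x)" if "\<forall>p. 0 \<le> f p" for f y
    using that c w unfolding set_lebesgue_integral_def
    by (intro mult_nonneg_nonneg Bochner_Integration.integral_nonneg) (auto simp: indicator_def)
qed

lemma positive_linear_kirchhoff_source:
  assumes "DIM('a::euclidean_space) = 3"
  shows "positive_linear_on (bounded_borel K) (kirchhoff_source :: ('a \<times> real \<Rightarrow> real) \<Rightarrow> _)"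
proof -
  have "positive_linear_on (bounded_borel K) (\<lambda>f (p :: 'a \<times> real). 1 / (4 * pi) *
    (LINT v:ball (fst p) (snd p)|lborel. f (v, snd p - norm (fst p - v)) / norm (fst p - v)))"
    by (rule positive_linear_on_integral)
      (auto simp: bounded_borel_def borel_prod[symmetric] intro: set_integrable_inverse_norm_ball[OF assms])
  then show ?thesis unfolding kirchhoff_source_def[abs_def] by (simp add: case_prod_beta')
qed

lemma positive_linear_kirchhoff_velocity:
  assumes "DIM('a::euclidean_space) = 3"
  shows "positive_linear_on (bounded_borel K) (kirchhoff_velocity :: ('a \<Rightarrow> real) \<Rightarrow> _)"
proof -
  \<comment> \<open>The factor \<open>1 / (4 * pi * t)\<close> is negative for \<open>t < 0\<close>,
    so it is replaced by 0 outside positive times. The operator is unchanged: the sphere is empty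
    for \<open>t < 0\<close>, and \<open>1 / 0 = 0\<close> at \<open>t = 0\<close>.\<close>
  have "positive_linear_on (bounded_borel K) (\<lambda>f (p :: 'a \<times> real). (if 0 < snd p then 1 / (4 * pi * snd p) else 0) *
    (LINT v:sphere (fst p) (snd p)|hausdorff_measure 2. f v / 1))"
  proof (rule positive_linear_on_integral)
    fix p :: "'a \<times> real" assume "(if 0 < snd p then 1 / (4 * pi * snd p) else 0) \<noteq> 0"
    then have "emeasure (hausdorff_measure 2) (sphere (fst p) (snd p)) < \<infinity>"
      using assms by (intro emeasure_hausdorff_sphere_finite) (auto split: if_splits)
    then show "set_integrable (hausdorff_measure 2) (sphere (fst p) (snd p)) (\<lambda>x. 1 / 1)"
      by (auto simp: set_integrable_def)
  qed (auto simp: bounded_borel_def measurable_cong_sets[OF sets_hausdorff_measure refl])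
  moreover have "kirchhoff_velocity = (\<lambda>f (p :: 'a \<times> real). (if 0 < snd p then 1 / (4 * pi * snd p) else 0) *
    (LINT v:sphere (fst p) (snd p)|hausdorff_measure 2. f v / 1))"
    by (auto simp: kirchhoff_velocity_def fun_eq_iff not_less le_less set_lebesgue_integral_def)
  ultimately show ?thesis by simp
qed

lemma positive_linear_poisson_velocity:
  assumes "DIM('a::euclidean_space) = 2"
  shows "positive_linear_on (bounded_borel K) (poisson_velocity :: ('a \<Rightarrow> real) \<Rightarrow> _)"
proof -
  have "positive_linear_on (bounded_borel K) (\<lambda>f (p :: 'a \<times> real). 1 / (2 * pi) *
    (LINT v:ball (fst p) (snd p)|lborel. f v / sqrt ((snd p)\<^sup>2 - (norm (fst p - v))\<^sup>2)))"
    by (rule positive_linear_on_integral)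
      (auto simp: bounded_borel_def dist_norm intro!: power_mono set_integrable_inverse_sqrt_ball(1)[OF assms])
  then show ?thesis unfolding poisson_velocity_def[abs_def] by (simp add: case_prod_beta')
qed

text \<open>The iterated integral is split: the inner one is positive and linear with the time
  \<open>s\<close> as an extra parameter, and the outer one preserves this once the inner value is
  known to be integrable in \<open>s\<close>.\<close>

lemma positive_linear_poisson_source:
  assumes "DIM('a::euclidean_space) = 2"
  shows "positive_linear_on (bounded_borel K) (poisson_source :: ('a \<times> real \<Rightarrow> real) \<Rightarrow> _)"
proof -
  define G :: "('a \<times> real \<Rightarrow> real) \<Rightarrow> ('a \<times> real) \<times> real \<Rightarrow> real" where
    "G = (\<lambda>f ((u, t), s). LINT v:ball u s|lborel. f (v, t - s) / sqrt (s\<^sup>2 - (norm (u - v))\<^sup>2))"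
  have "positive_linear_on (bounded_borel K) (\<lambda>f (y :: ('a \<times> real) \<times> real). 1 *
    (LINT v:ball (fst (fst y)) (snd y)|lborel.
      f (v, snd (fst y) - snd y) / sqrt ((snd y)\<^sup>2 - (norm (fst (fst y) - v))\<^sup>2)))"
    by (rule positive_linear_on_integral)
      (auto simp: bounded_borel_def borel_prod[symmetric] dist_norm
        intro!: power_mono set_integrable_inverse_sqrt_ball(1)[OF assms])
  then have G: "positive_linear_on (bounded_borel K) G"
    unfolding G_def by (simp add: case_prod_beta')
  have int: "set_integrable lborel {0<..<t} (\<lambda>s. G f ((u, t), s))"
    if f: "f \<in> bounded_borel K" for f u t
  proof -
    obtain C where C: "\<And>p. \<bar>f p\<bar> \<le> C" using f by (auto simp: bounded_borel_def bounded_iff)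
    have [measurable]: "f \<in> borel_measurable (borel \<Otimes>\<^sub>M borel)"
      using f by (simp add: bounded_borel_def borel_prod)
    have [measurable]: "(\<lambda>s. G f ((u, t), s)) \<in> borel_measurable lborel"
    proof -
      \<comment> \<open>The ball depends on \<open>s\<close>, so it is moved into the integrand,
        which is then jointly measurable in \<open>s\<close> and \<open>v\<close>.\<close>
      have "(\<lambda>s. LINT v|lborel. (if dist u v < s then 1 else 0) *\<^sub>R
          (f (v, t - s) / sqrt (s\<^sup>2 - (norm (u - v))\<^sup>2))) \<in> borel_measurable borel"
        by (intro lborel.borel_measurable_lebesgue_integral) measurable
      then show ?thesis
        by (simp add: G_def set_lebesgue_integral_def indicator_def)
    qed
    \<comment> \<open>The inner kernel has total mass \<open>2 * pi * s\<close>, at most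
      \<open>2 * pi * t\<close> on the time interval, and \<open>C\<close> bounds the
      source.\<close>
    have bound: "\<bar>G f ((u, t), s)\<bar> \<le> C * (2 * pi * t)" if s: "s \<in> {0<..<t}" for s
    proof -
      let ?w = "\<lambda>v. 1 / sqrt (s\<^sup>2 - (norm (u - v))\<^sup>2)"
      have w: "set_integrable lborel (ball u s) ?w"
        by (rule set_integrable_inverse_sqrt_ball(1)[OF assms])
      have "\<bar>G f ((u, t), s)\<bar> \<le> (LINT v:ball u s|lborel. C * ?w v)"
        unfolding G_def prod.case set_lebesgue_integral_def
      proof (rule integral_abs_bound_integral)
        have "bounded (range (\<lambda>v. f (v, t - s)))"
          using C by (auto simp: bounded_iff)
        then have "set_integrable lborel (ball u s) (\<lambda>v. f (v, t - s) * ?w v)"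
          by (intro set_integrable_bounded_mult w) auto
        then show "integrable lborel (\<lambda>v. indicator (ball u s) v *\<^sub>R
            (f (v, t - s) / sqrt (s\<^sup>2 - (norm (u - v))\<^sup>2)))"
          by (simp add: set_integrable_def)
        show "integrable lborel (\<lambda>v. indicator (ball u s) v *\<^sub>R (C * ?w v))"
          using set_integrable_mult_right[of C lborel "ball u s" ?w] w by (simp add: set_integrable_def)
        fix v
        have "(norm (u - v))\<^sup>2 \<le> s\<^sup>2" if "v \<in> ball u s"
          using that by (intro power_mono) (auto simp: dist_norm)
        then show "\<bar>indicator (ball u s) v *\<^sub>R (f (v, t - s) / sqrt (s\<^sup>2 - (norm (u - v))\<^sup>2))\<bar>
            \<le> indicator (ball u s) v *\<^sub>R (C * ?w v)"
          using C[of "(v, t - s)"] by (auto simp: indicator_def intro!: divide_right_mono)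
      qed
      also have "\<dots> = C * (2 * pi * s)"
        unfolding set_integral_mult_right
        using set_integrable_inverse_sqrt_ball(2)[OF assms, of s u] s by simp
      also have "\<dots> \<le> C * (2 * pi * t)"
        using s C[of "(u, t)"] by (intro mult_left_mono) auto
      finally show ?thesis .
    qed
    have finite: "emeasure lborel {0<..<t} < \<infinity>" by (cases "0 \<le> t") auto
    have "integrable lborel (\<lambda>s. indicator {0<..<t} s *\<^sub>R G f ((u, t), s))"
      by (rule integrableI_bounded_set_indicator[where B = "C * (2 * pi * t)"])
        (use bound finite in auto)
    then show ?thesis by (simp add: set_integrable_def)
  qed
  have P: "poisson_source f p = 1 / (2 * pi) * (LINT s:{0<..<snd p}|lborel. G f (p, s))" for f and p :: "'a \<times> real"
    by (simp add: poisson_source_def G_def case_prod_beta')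
  show ?thesis
    unfolding positive_linear_on_def
  proof (intro conjI ballI allI impI ext)
    fix f and p :: "'a \<times> real" assume f: "f \<in> bounded_borel K"
    have int_f: "set_integrable lborel {0<..<snd p} (\<lambda>s. G f (p, s))"
      using int[OF f, of "snd p" "fst p"] by simp
    show "poisson_source (\<lambda>p. f p + g p) p = poisson_source f p + poisson_source g p"
      if g: "g \<in> bounded_borel K" for g
      using int_f int[OF g, of "snd p" "fst p"]
      by (simp add: P positive_linear_onD(1)[OF G f g] algebra_simps add_divide_distrib)
    show "poisson_source (\<lambda>p. c * f p) p = c * poisson_source f p" for c
      by (simp add: P positive_linear_onD(2)[OF G f])
    show "0 \<le> poisson_source f p" if "\<forall>p. 0 \<le> f p"
      using positive_linear_onD(3)[OF G f] that unfolding P set_lebesgue_integral_def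
      by (intro mult_nonneg_nonneg Bochner_Integration.integral_nonneg) auto
  qed
qed

lemma positive_linear_wave_operators:
  assumes "DIM('a::euclidean_space) = 2 \<or> DIM('a) = 3"
  shows "positive_linear_on (bounded_borel K) (wave_source :: ('a \<times> real \<Rightarrow> real) \<Rightarrow> _)"
    and "positive_linear_on (bounded_borel K') (wave_velocity :: ('a \<Rightarrow> real) \<Rightarrow> _)"
  using assms positive_linear_poisson_source positive_linear_poisson_velocity
    positive_linear_kirchhoff_source positive_linear_kirchhoff_velocity
  by (auto simp: wave_source_def wave_velocity_def)

section \<open>Optimal recovery for the wave equation\<close>

theorem corollary9:
  fixes N :: "((real ^ 'd::finite) \<times> real) set" and k :: nat
    and M1 :: "((real ^ 'd) \<times> real) set" and M2 :: "(real ^ 'd) set"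
    and \<omega>1 \<omega>2 :: "real \<Rightarrow> real"
    and q1 :: "'n1::{finite,linorder} \<Rightarrow> (real ^ 'd) \<times> real"
    and q2 :: "'n2::{finite,linorder} \<Rightarrow> real ^ 'd"
    and e1 :: "real ^ ('n1::{finite,linorder})" and e2 :: "real ^ ('n2::{finite,linorder})"
    and Y :: "((real ^ 'd) \<times> real \<Rightarrow> real) set"
    and nrm :: "((real ^ 'd) \<times> real \<Rightarrow> real) \<Rightarrow> real"
  assumes "CARD('d) = 2 \<or> CARD('d) = 3"
    and "N \<subseteq> half_space" and "C1_submanifold k N"
    and "compact M1" and "M1 \<subseteq> half_space" and "compact M2"
    and "modulus_of_continuity \<omega>1" and "modulus_of_continuity \<omega>2"
    and "inj q1" and "range q1 \<subseteq> M1"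
    and "inj q2" and "range q2 \<subseteq> M2"
    and "\<And>j. 0 \<le> e1 $ j" and "\<And>j. 0 \<le> e2 $ j"
    and "normed_lattice (manifold_measure k N) Y nrm"
    and "\<And>g C. integrable (manifold_measure k N) g \<Longrightarrow>
           (AE p in manifold_measure k N. \<bar>g p\<bar> \<le> C) \<Longrightarrow> g \<in> Y"
    and "wave_source ` bounded_borel M1 \<subseteq> Y"
    and "wave_velocity ` bounded_borel M2 \<subseteq> Y"
  shows "let W = H_class half_space \<omega>1 M1 \<times> H_class UNIV \<omega>2 M2;
             I = map_prod (info q1) (info q2);
             U = error_box e1 \<times> error_box e2;
             L = map_prod (interpolant M1 \<omega>1 q1 e1) (interpolant M2 \<omega>2 q2 e2);
             \<Phi> = wave_operator \<circ> L;
             \<tau> = (tau M1 \<omega>1 q1 e1, tau M2 \<omega>2 q2 e2)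
         in optimal_recovery Y nrm wave_operator W I U \<Phi> \<and>
            optimal_error Y nrm wave_operator W I U = recovery_error nrm wave_operator W I U \<Phi> \<and>
            recovery_error nrm wave_operator W I U \<Phi> = ereal (nrm (wave_operator \<tau>))"
proof -
  have dim: "DIM(real ^ 'd) = 2 \<or> DIM(real ^ 'd) = 3" using assms(1) by simp
  note recovery = optimal_recovery_positive_linear[OF \<open>compact M1\<close> \<open>M1 \<subseteq> half_space\<close>
      \<open>compact M2\<close> subset_UNIV \<open>modulus_of_continuity \<omega>1\<close> \<open>modulus_of_continuity \<omega>2\<close>
      \<open>range q1 \<subseteq> M1\<close> \<open>range q2 \<subseteq> M2\<close> assms(13,14) \<open>normed_lattice (manifold_measure k N) Y nrm\<close>
      positive_linear_wave_operators(1)[OF dim] \<open>wave_source ` bounded_borel M1 \<subseteq> Y\<close>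
      positive_linear_wave_operators(2)[OF dim] \<open>wave_velocity ` bounded_borel M2 \<subseteq> Y\<close>
      wave_operator_def]
  show ?thesis
    unfolding Let_def optimal_recovery_def using recovery by simp
qed

end
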